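(* Let $Y_j\sim N(0,A_j)$, $j=1,\dots,J$, be independent Gaussian random vectors for some symmetric positive semi-definite $A_j\in\mathbb R^{d\times d}$. Let $A:=\sum_{j=1}^JA_j$ and $$\sigma^2:=\lambda_{max}\Big(\sum_{j=1}^J(\operatorname{trace}(A_j)A_j+2A_j^2)\Big),\qquad R:=\max_{j=1,\dots,J}\big(\operatorname{trace}(A_j)+4\|A_j\|\big).$$ Then we have, for $t>0$, the upper tail bound $$\mathbb P\Big(\lambda_{max}\Big(\sum_{j=1}^JY_jY_j^\top-A\Big)\ge t\Big)\le d\exp\Big(-\frac{t^2}{2\sigma^2+2Rt}\Big)$$ and the expectation bound $$\mathbb E\Big[\lambda_{max}\Big(\sum_{j=1}^JY_jY_j^\top-A\Big)\Big]\le\sigma\big(2\sqrt{\log d}+1\big)+4R\big(\log(d)+1\big).$$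
   Context: $\lambda_{max}$ is the largest eigenvalue of a symmetric matrix and $\|\cdot\|$ the spectral norm. *)

theory Defs
  imports "HOL-Probability.Probability"
begin

definition symmetric_matrix :: "real^'d^'d \<Rightarrow> bool" where
  "symmetric_matrix A \<longleftrightarrow> transpose A = A"

definition pos_semidef :: "real^'d^'d \<Rightarrow> bool" where
  "pos_semidef A \<longleftrightarrow> (\<forall>x. 0 \<le> x \<bullet> (A *v x))"

definition eigenvalues :: "real^'d^'d \<Rightarrow> real set" where
  "eigenvalues A = {c. \<exists>v. v \<noteq> 0 \<and> A *v v = c *\<^sub>R v}"

text \<open>Only meant for symmetric matrices, whose set of real eigenvalues is finite and nonempty.\<close>

definition lambda_max :: "real^'d^'d \<Rightarrow> real" where
  "lambda_max A = Max (eigenvalues A)"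

definition spectral_norm :: "real^'d^'d \<Rightarrow> real" where
  "spectral_norm A = onorm (\<lambda>x. A *v x)"

definition outer_self :: "real^'d \<Rightarrow> real^'d^'d" where
  "outer_self x = (\<chi> i k. x $ i * x $ k)"

text \<open>The normal law on the line with mean \<open>m\<close> and variance \<open>v \<ge> 0\<close>. The case \<open>v = 0\<close> is the
  point mass at \<open>m\<close>; it is needed because covariance matrices may be singular.\<close>

definition normal_law :: "real \<Rightarrow> real \<Rightarrow> real measure" where
  "normal_law m v =
    (if v = 0 then return borel m else density lborel (\<lambda>x. ennreal (normal_density m (sqrt v) x)))"

text \<open>\<open>Y \<sim> N(\<mu>, S)\<close>: every linear functional \<open>u \<bullet> Y\<close> is normal with mean \<open>u \<bullet> \<mu>\<close> and
  variance \<open>u\<^sup>T S u\<close>.\<close>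

definition gaussian_vector ::
    "'a measure \<Rightarrow> ('a \<Rightarrow> real^'d) \<Rightarrow> real^'d \<Rightarrow> real^'d^'d \<Rightarrow> bool" where
  "gaussian_vector M Y \<mu> S \<longleftrightarrow>
    Y \<in> borel_measurable M \<and>
    (\<forall>u. distr M borel (\<lambda>\<omega>. u \<bullet> Y \<omega>) = normal_law (u \<bullet> \<mu>) (u \<bullet> (S *v u)))"

end

(* The proof follows the matrix Laplace transform method. By Lieb's theorem the trace of the
   matrix moment generating function is subadditive over independent summands:
   E tr exp (H + sum X_j) <= tr exp (H + sum log E exp X_j).
   The theorem is applied to the uncentred summands X_j = theta Y_j Y_j^T, with H = - theta A.

   Lieb's theorem itself comes from the joint convexity of the relative entropy
   tr e^K (K - L) - tr e^K + tr e^L in the pair (e^K, e^L). In eigenbases of both matrices this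
   entropy is the sum of c_ij^2 (a ln (a/b) - a + b), where c_ij are the inner products of the basis
   vectors and a, b the eigenvalues of e^K, e^L; moreover
   a ln (a/b) - a + b = int_0^1 r (a - b)^2 / (r b + (1 - r) a) dr.
   The integrand is a maximum over z of r (2 z (a - b) - z^2 (r b + (1 - r) a)), so that for matrices it is a
   supremum of linear functionals of (e^K, e^L). Integrating the optimal ones yields a linear
   functional that touches the entropy at a prescribed pair, and Jensen's inequality becomes
   linearity of the expectation.

   The moment bound E |Y|^(2n) Y Y^T <= (n+1)!/2 R^(n-1) (tr(S) S + 2 S^2) for Y ~ N(0, S) follows from
   Gaussian integration by parts. Only the laws of the linear functionals of Y are given, so
   integration by parts is first shown for powers of linear forms, and then for products by
   differentiating in the direction of each new factor. *)

theory Submission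
  imports Defs
begin

section \<open>Spectral theorem for symmetric matrices\<close>

text \<open>Centring is postponed because powers of the rank one matrix Y Y^T collapse, (Y
  Y^T)^(n+1) = |Y|^(2n) Y Y^T, while powers of Y Y^T - S do not; the linear term theta S of the log
  moment generating function is then cancelled exactly by H. The relative entropy fits Lieb's
  theorem because for the pair (H + X, X) the logarithms differ by the constant H, which makes the
  entropy of that pair linear in the two exponentials. The matrix tr(S) S + 2 S^2 is E |Y|^2 Y Y^T.
  The factor (n+1)!/2 in the moment bound turns the exponential series into a geometric one and
  gives log E exp(theta Y Y^T) <= theta S + theta^2 / (2 (1 - theta R)) (tr(S) S + 2 S^2) for theta
  >= 0, theta R < 1. What remains is the scalar choice of theta: t / (sigma^2 + R t) for the tail
  and 1 / (v + R) with a free v > 0 for the expectation, with degenerate parameters treated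
  apart.\<close>

definition onb :: "('d \<Rightarrow> real^'d) \<Rightarrow> bool" where
  "onb u \<longleftrightarrow> (\<forall>i j. u i \<bullet> u j = (if i = j then 1 else 0))"

text \<open>Spectral calculus is phrased through this relation: a function of \<open>A\<close> is a
  matrix with the same \<open>u\<close> and transformed \<open>a\<close>, so no diagonal matrices or
  conjugations occur.\<close>

definition eigenbasis :: "real^'d^'d \<Rightarrow> ('d \<Rightarrow> real^'d) \<Rightarrow> ('d \<Rightarrow> real) \<Rightarrow> bool" where
  "eigenbasis A u a \<longleftrightarrow> onb u \<and> (\<forall>i. A *v u i = a i *\<^sub>R u i)"

lemma onb_inner: "onb u \<Longrightarrow> u i \<bullet> u j = (if i = j then 1 else 0)"
  by (simp add: onb_def)

text \<open>The family is indexed by the coordinate type \<open>'d\<close>, so the matrix with rows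
  \<open>u i\<close> is square; its one-sided inverse is two-sided, and orthonormality already gives
  completeness.\<close>

lemma onb_expand:
  fixes x :: "real^'d"
  assumes "onb u"
  shows "x = (\<Sum>i\<in>UNIV. (u i \<bullet> x) *\<^sub>R u i)"
proof -
  define P :: "real^'d^'d" where "P = (\<chi> i. u i)"
  have "P ** transpose P = mat 1"
    using assms by (simp add: matrix_mult_transpose_dot_row vec_eq_iff mat_def row_def P_def onb_def)
  then have "transpose P ** P = mat 1"
    by (simp add: matrix_left_right_inverse)
  then have "transpose P *v (P *v x) = x"
    by (simp add: matrix_vector_mul_assoc)
  moreover have "transpose P *v (P *v x) = (\<Sum>i\<in>UNIV. (u i \<bullet> x) *\<^sub>R u i)"
    by (simp add: vec_eq_iff matrix_vector_mult_def transpose_def P_def inner_vec_def mult.commute)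
  ultimately show ?thesis by simp
qed

lemma onb_parseval:
  fixes x y :: "real^'d"
  assumes "onb u"
  shows "x \<bullet> y = (\<Sum>i\<in>UNIV. (u i \<bullet> x) * (u i \<bullet> y))"
proof -
  have "x \<bullet> y = (\<Sum>i\<in>UNIV. (u i \<bullet> x) *\<^sub>R u i) \<bullet> y"
    using onb_expand[OF assms, of x] by simp
  then show ?thesis by (simp add: inner_sum_left)
qed

lemma onb_matrix_eqI:
  fixes A B :: "real^'d^'d"
  assumes "onb u" and "\<And>i. A *v u i = B *v u i"
  shows "A = B"
proof -
  have "A *v x = B *v x" for x
    by (subst (1 2) onb_expand[OF assms(1)])
       (simp add: matrix_vector_mult_scaleR linear_sum[OF matrix_vector_mul_linear] o_def assms(2))
  then show ?thesis by (simp add: matrix_eq)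
qed

lemma symmetric_matrix_inner:
  "symmetric_matrix A \<Longrightarrow> x \<bullet> (A *v y) = (A *v x) \<bullet> y"
  by (metis symmetric_matrix_def dot_lmul_matrix transpose_matrix_vector)

lemma symmetric_matrixI:
  assumes "\<And>x y. x \<bullet> (A *v y) = (A *v x) \<bullet> y"
  shows "symmetric_matrix A"
proof -
  have "A $ i $ j = A $ j $ i" for i j
    using assms[of "axis i 1" "axis j 1"]
    by (simp add: inner_axis inner_axis' matrix_vector_mult_basis column_def)
  then show ?thesis by (simp add: symmetric_matrix_def transpose_def vec_eq_iff)
qed

text \<open>A maximiser \<open>x\<close> of the Rayleigh quotient on the unit sphere of
  \<open>W\<close> exists by compactness. The form \<open>q\<close> is nonnegative on
  \<open>W\<close> and vanishes at \<open>x\<close>, so its gradient there, twice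
  \<open>c x - A x\<close>, must vanish within \<open>W\<close>.\<close>

lemma rayleigh_eigenvector:
  fixes A :: "real^'d^'d"
  assumes sym: "symmetric_matrix A" and W: "subspace W" "w \<in> W" "w \<noteq> 0"
    and inv: "\<And>x. x \<in> W \<Longrightarrow> A *v x \<in> W"
  obtains x c where "x \<in> W" "norm x = 1" "A *v x = c *\<^sub>R x"
proof -
  let ?K = "W \<inter> sphere 0 1"
  have "compact ?K"
    using closed_subspace[OF W(1)] by (intro closed_Int_compact) auto
  moreover have "(1 / norm w) *\<^sub>R w \<in> ?K"
    using W by (auto intro: subspace_scale)
  moreover have "continuous_on ?K (\<lambda>x. x \<bullet> (A *v x))"
    by (intro continuous_intros linear_continuous_on matrix_vector_mul_bounded_linear)
  ultimately obtain x where x: "x \<in> ?K" and max: "\<And>y. y \<in> ?K \<Longrightarrow> y \<bullet> (A *v y) \<le> x \<bullet> (A *v x)"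
    using continuous_attains_sup[of ?K] by blast
  define c where "c = x \<bullet> (A *v x)"
  define q where "q = (\<lambda>z. c * (z \<bullet> z) - z \<bullet> (A *v z))"
  have q: "q z \<ge> 0" if "z \<in> W" for z
  proof (cases "z = 0")
    case False
    let ?y = "(1 / norm z) *\<^sub>R z"
    have "?y \<in> ?K" using that W False by (auto intro: subspace_scale)
    from max[OF this] have "(z \<bullet> (A *v z)) / (norm z)\<^sup>2 \<le> c"
      by (simp add: c_def matrix_vector_mult_scaleR power2_eq_square)
    then show ?thesis using False
      by (simp add: q_def divide_le_eq power2_norm_eq_inner)
  qed (simp add: q_def)
  have xx: "x \<bullet> x = 1" and xW: "x \<in> W" using x by (auto simp: norm_eq_1)
  define y where "y = c *\<^sub>R x - A *v x"
  have yW: "y \<in> W"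
    using xW inv W(1) unfolding y_def by (intro subspace_diff subspace_scale) auto
  define n where "n = y \<bullet> y"
  \<comment> \<open>There is no constant term because \<open>q x = 0\<close>.\<close>
  have exp: "q (x + e *\<^sub>R y) = 2 * e * n + e\<^sup>2 * q y" for e
  proof -
    have "x \<bullet> (A *v y) = y \<bullet> (A *v x)"
      by (metis symmetric_matrix_inner[OF sym] inner_commute)
    moreover have "n = c * (x \<bullet> y) - y \<bullet> (A *v x)"
      unfolding n_def by (subst (2) y_def) (simp add: inner_diff_right inner_commute)
    ultimately show ?thesis
      using xx by (simp add: q_def c_def[symmetric] matrix_vector_right_distrib matrix_vector_mult_scaleR
        inner_add_left inner_add_right inner_commute[of y x] power2_eq_square distrib_left right_diff_distrib)
  qed
  have "n = 0"
  proof (rule ccontr)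
    assume "n \<noteq> 0"
    then have n: "n > 0" by (simp add: n_def)
    \<comment> \<open>A negative step makes the linear term win over the quadratic one; adding 1 in
      the denominator also covers \<open>q y = 0\<close>.\<close>
    let ?q = "q y" let ?e = "- n / (?q + 1)"
    have q0: "?q \<ge> 0" using q yW by simp
    have "0 \<le> 2 * ?e * n + ?e\<^sup>2 * ?q"
      using q[of "x + ?e *\<^sub>R y"] subspace_add[OF W(1) xW subspace_scale[OF W(1) yW, of ?e]]
      unfolding exp by blast
    also have "\<dots> = n\<^sup>2 * (- ?q - 2) / (?q + 1)\<^sup>2"
      using q0 by (simp add: field_simps power2_eq_square add_nonneg_eq_0_iff)
    also have "\<dots> < 0"
      using n q0 by (intro divide_neg_pos mult_pos_neg) auto
    finally show False by simp
  qed
  then have "A *v x = c *\<^sub>R x" by (simp add: n_def y_def)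
  then show thesis using that[of x c] x by simp
qed

text \<open>Eigenvectors are collected one at a time: by symmetry the orthogonal complement of those
  already found is invariant, and it is nonzero as long as fewer than the dimension are
  found.\<close>

theorem spectral_theorem:
  fixes A :: "real^'d^'d"
  assumes sym: "symmetric_matrix A"
  obtains u a where "eigenbasis A u a"
proof -
  have "\<exists>S :: (real^'d) set. finite S \<and> card S = k \<and> pairwise orthogonal S
      \<and> (\<forall>x\<in>S. norm x = 1 \<and> (\<exists>c. A *v x = c *\<^sub>R x))"
    if "k \<le> CARD('d)" for k
    using that
  proof (induction k)
    case 0
    show ?case by (intro exI[of _ "{}"]) (simp add: pairwise_def)
  next
    case (Suc k)
    then obtain S where S: "finite S" "card S = k" "pairwise orthogonal S"
      "\<And>x. x \<in> S \<Longrightarrow> norm x = 1" "\<And>x. x \<in> S \<Longrightarrow> \<exists>c. A *v x = c *\<^sub>R x"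
      by auto
    let ?W = "{x. \<forall>v\<in>S. v \<bullet> x = 0}"
    have "dim S < DIM(real^'d)" using dim_le_card'[OF S(1)] S(2) Suc.prems by simp
    from orthogonal_to_subspace_exists[OF this]
    obtain w where w: "w \<noteq> 0" "\<And>y. y \<in> span S \<Longrightarrow> orthogonal w y" by blast
    have wW: "w \<in> ?W" using w(2) by (auto simp: orthogonal_def inner_commute span_base)
    have sub: "subspace ?W" by (auto simp: subspace_def inner_add_right)
    have inv: "A *v x \<in> ?W" if "x \<in> ?W" for x
    proof -
      have "v \<bullet> (A *v x) = 0" if "v \<in> S" for v
        unfolding symmetric_matrix_inner[OF sym] using S(5)[OF that] \<open>x \<in> ?W\<close> that by auto
      then show ?thesis by blast
    qed
    obtain x c where x: "x \<in> ?W" "norm x = 1" "A *v x = c *\<^sub>R x"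
      using rayleigh_eigenvector[OF sym sub wW w(1) inv] .
    have "x \<notin> S" using x(1,2) by (auto simp: norm_eq_1)
    then have "card (insert x S) = Suc k" "finite (insert x S)" using S(1,2) by auto
    moreover have "pairwise orthogonal (insert x S)"
      using S(3) x(1) by (auto simp: pairwise_insert orthogonal_def inner_commute)
    moreover have "norm y = 1 \<and> (\<exists>c. A *v y = c *\<^sub>R y)" if "y \<in> insert x S" for y
      using that S(4,5) x(2,3) by blast
    ultimately show ?case by blast
  qed
  from this[OF order_refl] obtain S :: "(real^'d) set"
    where S: "finite S" "card S = CARD('d)" "pairwise orthogonal S"
      "\<And>x. x \<in> S \<Longrightarrow> norm x = 1" "\<And>x. x \<in> S \<Longrightarrow> \<exists>c. A *v x = c *\<^sub>R x" by blast
  then obtain u where u: "bij_betw u (UNIV :: 'd set) S"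
    using finite_same_card_bij[of "UNIV :: 'd set" S] by auto
  have "u i \<bullet> u j = 0" if "i \<noteq> j" for i j
    using S(3) bij_betwE[OF u] that bij_betw_imp_inj_on[OF u]
    by (simp add: pairwise_def orthogonal_def inj_eq)
  then have "onb u"
    using S(4) bij_betwE[OF u] by (auto simp: onb_def norm_eq_1[symmetric])
  moreover have "\<forall>i. \<exists>c. A *v u i = c *\<^sub>R u i"
    using S(5) bij_betwE[OF u] by blast
  then obtain a where "\<forall>i. A *v u i = a i *\<^sub>R u i" by metis
  ultimately have "eigenbasis A u a" by (simp add: eigenbasis_def)
  then show thesis by (rule that)
qed

text \<open>The inner product on \<open>real^'d^'d\<close> is the Frobenius one. Two different bases
  are allowed so that eigenbases of two noncommuting matrices can be used at once.\<close>

lemma matrix_inner_onb: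
  fixes Z W :: "real^'d^'d"
  assumes "onb u" "onb v"
  shows "Z \<bullet> W = (\<Sum>i\<in>UNIV. \<Sum>j\<in>UNIV. (u i \<bullet> (Z *v v j)) * (u i \<bullet> (W *v v j)))"
proof -
  have "Z \<bullet> W = (\<Sum>k\<in>UNIV. Z $ k \<bullet> W $ k)" by (simp add: inner_vec_def)
  also have "\<dots> = (\<Sum>k\<in>UNIV. \<Sum>j\<in>UNIV. (Z *v v j) $ k * (W *v v j) $ k)"
    by (subst onb_parseval[OF assms(2)]) (simp add: matrix_vector_mul_component inner_commute)
  also have "\<dots> = (\<Sum>j\<in>UNIV. (Z *v v j) \<bullet> (W *v v j))"
    by (subst sum.swap) (simp add: inner_vec_def)
  also have "\<dots> = (\<Sum>j\<in>UNIV. \<Sum>i\<in>UNIV. (u i \<bullet> (Z *v v j)) * (u i \<bullet> (W *v v j)))"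
    by (subst onb_parseval[OF assms(1)]) simp
  finally show ?thesis by (subst sum.swap)
qed

lemma trace_onb:
  assumes "onb u"
  shows "trace A = (\<Sum>i\<in>UNIV. u i \<bullet> (A *v u i))"
proof -
  have "trace A = A \<bullet> mat 1"
    by (simp add: trace_def inner_vec_def mat_def if_distrib cong: if_cong)
  also have "\<dots> = (\<Sum>i\<in>UNIV. \<Sum>j\<in>UNIV. (u i \<bullet> (A *v u j)) * (if i = j then 1 else 0))"
    by (subst matrix_inner_onb[OF assms assms]) (simp add: onb_inner[OF assms])
  finally show ?thesis by (simp add: if_distrib cong: if_cong)
qed

lemma eigenbasis_trace:
  "eigenbasis A u a \<Longrightarrow> trace A = sum a UNIV"
  by (simp add: trace_onb[of u] eigenbasis_def onb_inner)

lemma eigenbasis_symmetric: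
  assumes "eigenbasis A u a"
  shows "symmetric_matrix A"
proof -
  have u: "onb u" and Au: "\<And>i. A *v u i = a i *\<^sub>R u i"
    using assms by (auto simp: eigenbasis_def)
  have *: "A *v x = (\<Sum>i\<in>UNIV. (a i * (u i \<bullet> x)) *\<^sub>R u i)" for x
    by (subst onb_expand[OF u, of x])
       (simp add: linear_sum[OF matrix_vector_mul_linear] matrix_vector_mult_scaleR Au mult.commute)
  show ?thesis
    by (rule symmetric_matrixI) (simp add: * inner_sum_left inner_sum_right ac_simps inner_commute)
qed

lemma eigenbasis_quadratic:
  assumes "eigenbasis A u a"
  shows "x \<bullet> (A *v x) = (\<Sum>i\<in>UNIV. a i * (u i \<bullet> x)\<^sup>2)"
proof -
  have u: "onb u" and Au: "\<And>i. A *v u i = a i *\<^sub>R u i"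
    using assms by (auto simp: eigenbasis_def)
  have "u i \<bullet> (A *v x) = a i * (u i \<bullet> x)" for i
    by (simp only: symmetric_matrix_inner[OF eigenbasis_symmetric[OF assms]] Au inner_scaleR_left)
  then show ?thesis
    by (subst onb_parseval[OF u]) (simp add: power2_eq_square mult_ac)
qed

lemma eigenbasis_exists:
  assumes "onb u"
  obtains A where "eigenbasis A u a"
proof
  let ?f = "\<lambda>x. \<Sum>i\<in>UNIV. (a i * (u i \<bullet> x)) *\<^sub>R u i"
  have "linear ?f"
    by (auto simp: linear_iff inner_add_right algebra_simps scaleR_sum_right sum.distrib)
  then show "eigenbasis (matrix ?f) u a"
    using assms by (simp add: eigenbasis_def matrix_works onb_inner if_distrib if_distribR cong: if_cong)
qed

lemma eigenbasis_eigenvalues: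
  assumes "eigenbasis A u a"
  shows "eigenvalues A = range a"
proof -
  have u: "onb u" and Au: "\<And>i. A *v u i = a i *\<^sub>R u i"
    using assms by (auto simp: eigenbasis_def)
  have "c \<in> range a" if v: "v \<noteq> 0" "A *v v = c *\<^sub>R v" for c v
  proof -
    have "(\<Sum>i\<in>UNIV. (u i \<bullet> v) * (u i \<bullet> v)) \<noteq> 0"
      using v(1) unfolding onb_parseval[OF u, of v v, symmetric] by simp
    then obtain i where i: "u i \<bullet> v \<noteq> 0"
      by (metis (no_types, lifting) mult_zero_left sum.neutral)
    have "u i \<bullet> (A *v v) = a i * (u i \<bullet> v)"
      by (simp only: symmetric_matrix_inner[OF eigenbasis_symmetric[OF assms]] Au inner_scaleR_left)
    then have "c = a i" using i v(2) by simp
    then show ?thesis by simp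
  qed
  moreover have "u i \<noteq> 0" for i using onb_inner[OF u, of i i] by auto
  then have "a i \<in> eigenvalues A" for i using Au by (auto simp: eigenvalues_def)
  ultimately show ?thesis by (auto simp: eigenvalues_def)
qed

section \<open>The largest eigenvalue as maximal Rayleigh quotient\<close>

lemma eigenbasis_lambda_max:
  "eigenbasis A u a \<Longrightarrow> lambda_max A = Max (range a)"
  by (simp add: lambda_max_def eigenbasis_eigenvalues)

lemma quadratic_le_lambda_max:
  assumes "symmetric_matrix A"
  shows "x \<bullet> (A *v x) \<le> lambda_max A * (x \<bullet> x)"
proof -
  obtain u a where e: "eigenbasis A u a" using spectral_theorem[OF assms] .
  have "(\<Sum>i\<in>UNIV. a i * (u i \<bullet> x)\<^sup>2) \<le> (\<Sum>i\<in>UNIV. lambda_max A * (u i \<bullet> x)\<^sup>2)"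
    by (intro sum_mono mult_right_mono) (simp_all add: eigenbasis_lambda_max[OF e])
  also have "\<dots> = lambda_max A * (x \<bullet> x)"
    using e by (subst onb_parseval[of u]) (simp_all add: sum_distrib_left power2_eq_square eigenbasis_def)
  finally show ?thesis by (simp add: eigenbasis_quadratic[OF e])
qed

lemma lambda_max_attained:
  assumes "symmetric_matrix A"
  obtains x where "norm x = 1" "x \<bullet> (A *v x) = lambda_max A"
proof -
  obtain u a where e: "eigenbasis A u a" using spectral_theorem[OF assms] .
  have "Max (range a) \<in> range a" by (intro Max_in) auto
  then obtain i where "lambda_max A = a i" using eigenbasis_lambda_max[OF e] by (metis imageE)
  then show thesis
    using that[of "u i"] e by (simp add: eigenbasis_def onb_inner norm_eq_1)
qed

section \<open>Matrix exponential\<close>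

primrec matpow :: "real^'d^'d \<Rightarrow> nat \<Rightarrow> real^'d^'d" where
  "matpow A 0 = mat 1"
| "matpow A (Suc n) = A ** matpow A n"

text \<open>Defined entrywise by the power series, so that measurability is immediate; meaningful where the
  series converge, in particular for symmetric matrices.\<close>

definition mexp :: "real^'d^'d \<Rightarrow> real^'d^'d" where
  "mexp A = (\<chi> i k. \<Sum>n. matpow A n $ i $ k / fact n)"

lemma matpow_eigenvector:
  assumes "A *v v = c *\<^sub>R v"
  shows "matpow A n *v v = c ^ n *\<^sub>R v"
proof (induction n)
  case (Suc n)
  have "matpow A (Suc n) *v v = A *v (matpow A n *v v)"
    by (simp add: matrix_vector_mul_assoc)
  then show ?case by (simp add: Suc matrix_vector_mult_scaleR assms)
qed simp

lemma eigenbasis_entry: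
  assumes "onb u" and "\<And>l. B *v u l = b l *\<^sub>R u l"
  shows "B $ i $ k = (\<Sum>l\<in>UNIV. b l * (u l $ i * u l $ k))"
proof -
  have "B $ i $ k = axis i 1 \<bullet> (B *v axis k 1)"
    by (simp add: inner_axis' matrix_vector_mult_basis column_def)
  also have "B *v axis k 1 = (\<Sum>l\<in>UNIV. u l $ k *\<^sub>R b l *\<^sub>R u l)"
    by (subst onb_expand[OF assms(1), of "axis k 1"])
       (simp add: linear_sum[OF matrix_vector_mul_linear] matrix_vector_mult_scaleR assms(2) inner_axis)
  finally show ?thesis by (simp add: inner_axis' mult_ac)
qed

text \<open>In an eigenbasis each entry of the series is a fixed finite combination of the scalar
  exponential series, so convergence and value come together.\<close>

lemma matpow_sums_exp:
  assumes e: "eigenbasis A u a" and B: "eigenbasis B u (\<lambda>i. exp (a i))"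
  shows "(\<lambda>n. matpow A n $ i $ k / fact n) sums (B $ i $ k)"
proof -
  have u: "onb u" and Au: "\<And>i. A *v u i = a i *\<^sub>R u i"
    using e by (auto simp: eigenbasis_def)
  have 1: "matpow A n $ i $ k / fact n = (\<Sum>l\<in>UNIV. (a l ^ n /\<^sub>R fact n) * (u l $ i * u l $ k))" for n
    unfolding eigenbasis_entry[OF u matpow_eigenvector[OF Au]] sum_divide_distrib
    by (simp add: divide_simps)
  have 2: "B $ i $ k = (\<Sum>l\<in>UNIV. exp (a l) * (u l $ i * u l $ k))"
    using B by (intro eigenbasis_entry) (auto simp: eigenbasis_def)
  show ?thesis
    unfolding 1 2 by (intro sums_sum sums_mult2 exp_converges)
qed

lemma mexp_eigenbasis:
  assumes e: "eigenbasis A u a"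
  shows "eigenbasis (mexp A) u (\<lambda>i. exp (a i))"
proof -
  have u: "onb u" using e by (simp add: eigenbasis_def)
  obtain B where B: "eigenbasis B u (\<lambda>i. exp (a i))" using eigenbasis_exists[OF u] .
  have "mexp A = B"
  proof -
    have "mexp A $ i $ k = B $ i $ k" for i k
      using sums_unique[OF matpow_sums_exp[OF e B, of i k]] by (simp add: mexp_def)
    then show ?thesis by (simp add: vec_eq_iff)
  qed
  with B show ?thesis by simp
qed

lemma mexp_sums:
  assumes "symmetric_matrix A"
  shows "(\<lambda>n. matpow A n $ i $ k / fact n) sums (mexp A $ i $ k)"
proof -
  obtain u a where e: "eigenbasis A u a" using spectral_theorem[OF assms] .
  show ?thesis by (rule matpow_sums_exp[OF e mexp_eigenbasis[OF e]])
qed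

lemma mexp_symmetric:
  assumes "symmetric_matrix A"
  shows "symmetric_matrix (mexp A)"
proof -
  obtain u a where "eigenbasis A u a" using spectral_theorem[OF assms] .
  then show ?thesis using mexp_eigenbasis eigenbasis_symmetric by blast
qed

lemma mexp_trace: "eigenbasis A u a \<Longrightarrow> trace (mexp A) = (\<Sum>i\<in>UNIV. exp (a i))"
  using eigenbasis_trace[OF mexp_eigenbasis] .

lemma mexp_eqI:
  assumes "eigenbasis A u a" "eigenbasis B u (\<lambda>i. exp (a i))"
  shows "mexp A = B"
proof (rule onb_matrix_eqI)
  show "onb u" using assms by (simp add: eigenbasis_def)
  show "mexp A *v u i = B *v u i" for i
    using mexp_eigenbasis[OF assms(1)] assms(2) by (simp add: eigenbasis_def)
qed

lemma mexp_shift: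
  assumes "symmetric_matrix A"
  shows "mexp (c *\<^sub>R mat 1 + A) = exp c *\<^sub>R mexp A"
proof -
  obtain u a where e: "eigenbasis A u a" using spectral_theorem[OF assms] .
  have "eigenbasis (c *\<^sub>R mat 1 + A) u (\<lambda>i. c + a i)"
    using e unfolding eigenbasis_def matrix_vector_mult_add_rdistrib scaleR_matrix_vector_assoc[symmetric]
    by (auto simp: scaleR_add_left)
  moreover have "eigenbasis (exp c *\<^sub>R mexp A) u (\<lambda>i. exp (c + a i))"
    using mexp_eigenbasis[OF e] unfolding eigenbasis_def scaleR_matrix_vector_assoc[symmetric]
    by (auto simp: exp_add)
  ultimately show ?thesis by (rule mexp_eqI)
qed

lemma posdef_log:
  assumes sym: "symmetric_matrix B" and pos: "\<And>x. x \<noteq> 0 \<Longrightarrow> 0 < x \<bullet> (B *v x)"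
  obtains K where "symmetric_matrix K" "mexp K = B"
proof -
  obtain u b where e: "eigenbasis B u b" using spectral_theorem[OF sym] .
  then have u: "onb u" by (simp add: eigenbasis_def)
  obtain K where K: "eigenbasis K u (\<lambda>i. ln (b i))" using eigenbasis_exists[OF u] .
  have "b i > 0" for i
  proof -
    have "u i \<noteq> 0" using onb_inner[OF u, of i i] by auto
    from pos[OF this] show ?thesis using e by (simp add: eigenbasis_def onb_inner)
  qed
  then have "(\<lambda>i. exp (ln (b i))) = b" by simp
  then have "mexp K = B" using e by (intro mexp_eqI[OF K]) (simp only:)
  then show thesis using that eigenbasis_symmetric[OF K] by blast
qed

lemma mexp_posdef:
  assumes "symmetric_matrix A" "x \<noteq> 0"
  shows "0 < x \<bullet> (mexp A *v x)"
proof -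
  obtain u a where e: "eigenbasis A u a" using spectral_theorem[OF assms(1)] .
  then have u: "onb u" by (simp add: eigenbasis_def)
  have "(\<Sum>i\<in>UNIV. (u i \<bullet> x) * (u i \<bullet> x)) \<noteq> 0"
    using assms(2) unfolding onb_parseval[OF u, of x x, symmetric] by simp
  then obtain i where i: "u i \<bullet> x \<noteq> 0"
    by (metis (no_types, lifting) mult_zero_left sum.neutral)
  have "0 < (\<Sum>i\<in>UNIV. exp (a i) * (u i \<bullet> x)\<^sup>2)"
    using i by (intro sum_pos2[of _ i]) auto
  then show ?thesis by (simp add: eigenbasis_quadratic[OF mexp_eigenbasis[OF e]])
qed

section \<open>Measurability of matrix-valued maps and of the matrix exponential\<close>

lemma borel_measurable_matrixI:
  fixes X :: "'a \<Rightarrow> real^'d^'e"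
  assumes "\<And>i k. (\<lambda>\<omega>. X \<omega> $ i $ k) \<in> borel_measurable M"
  shows "X \<in> borel_measurable M"
proof (rule borel_measurable_euclidean_space[THEN iffD2], rule ballI)
  fix b :: "real^'d^'e" assume "b \<in> Basis"
  then obtain i k where "b = axis i (axis k 1)" by (auto simp: Basis_vec_def)
  then show "(\<lambda>\<omega>. X \<omega> \<bullet> b) \<in> borel_measurable M"
    using assms[of i k] by (simp add: inner_axis)
qed

lemma borel_measurable_vec_nth [measurable (raw)]:
  fixes X :: "'a \<Rightarrow> 'b::{second_countable_topology, real_normed_vector}^'d"
  assumes "X \<in> borel_measurable M"
  shows "(\<lambda>\<omega>. X \<omega> $ i) \<in> borel_measurable M"
  by (rule measurable_compose[OF assms borel_measurable_continuous_onI])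
     (intro continuous_intros)

lemma borel_measurable_mexp [measurable (raw)]:
  fixes X :: "'a \<Rightarrow> real^'d^'d"
  assumes [measurable]: "X \<in> borel_measurable M"
  shows "(\<lambda>\<omega>. mexp (X \<omega>)) \<in> borel_measurable M"
proof -
  have [measurable]: "(\<lambda>\<omega>. matpow (X \<omega>) n $ i $ k) \<in> borel_measurable M" for n i k
  proof (induction n arbitrary: i k)
    case (Suc n)
    note [measurable] = Suc
    show ?case unfolding matpow.simps matrix_matrix_mult_def vec_lambda_beta by measurable
  qed simp
  show ?thesis
    unfolding mexp_def by (rule borel_measurable_matrixI, unfold vec_lambda_beta) measurable
qed

section \<open>Relative entropy\<close>

text \<open>Parametrised by the logarithms of its two positive definite arguments, so that no
  logarithm function on matrices is involved.\<close>

definition relent :: "real^'d^'d \<Rightarrow> real^'d^'d \<Rightarrow> real" where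
  "relent K L = mexp K \<bullet> (K - L) - trace (mexp K) + trace (mexp L)"

lemma trace_inner_mat: "trace (A :: real^'d^'d) = A \<bullet> mat 1"
  by (simp add: trace_def inner_vec_def mat_def if_distrib cong: if_cong)

lemma eigenbasis_inner_left:
  assumes "eigenbasis A u a"
  shows "u i \<bullet> (A *v x) = a i * (u i \<bullet> x)"
proof -
  have "A *v u i = a i *\<^sub>R u i" using assms by (simp add: eigenbasis_def)
  then show ?thesis
    by (simp only: symmetric_matrix_inner[OF eigenbasis_symmetric[OF assms]] inner_scaleR_left)
qed

lemma relent_eigen:
  assumes K: "eigenbasis K u k" and L: "eigenbasis L v l"
  shows "relent K L = (\<Sum>i\<in>UNIV. \<Sum>j\<in>UNIV.
    (u i \<bullet> v j)\<^sup>2 * (exp (k i) * (k i - l j) - exp (k i) + exp (l j)))"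
proof -
  have u: "onb u" and v: "onb v" using K L by (auto simp: eigenbasis_def)
  have Lv: "L *v v j = l j *\<^sub>R v j" "mexp L *v v j = exp (l j) *\<^sub>R v j" for j
    using L mexp_eigenbasis[OF L] by (auto simp: eigenbasis_def)
  note in1 = matrix_inner_onb[OF u v]
  note in2 = eigenbasis_inner_left[OF K] eigenbasis_inner_left[OF mexp_eigenbasis[OF K]]
  show ?thesis
    unfolding relent_def trace_inner_mat in1 matrix_vector_mult_diff_rdistrib inner_diff_right
      in2 Lv inner_scaleR_right matrix_vector_mul_lid sum_subtractf[symmetric] sum.distrib[symmetric]
    by (intro sum.cong refl) (simp add: power2_eq_square algebra_simps)
qed

text \<open>Klein's inequality. The double eigenexpansion reduces it to scalars, where it is 1 + s
  <= e^s at s = y - x.\<close>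

lemma relent_nonneg:
  assumes "symmetric_matrix K" "symmetric_matrix L"
  shows "0 \<le> relent K L"
proof -
  obtain u k where K: "eigenbasis K u k" using spectral_theorem[OF assms(1)] .
  obtain v l where L: "eigenbasis L v l" using spectral_theorem[OF assms(2)] .
  have "0 \<le> exp x * (x - y) - exp x + exp y" for x y :: real
  proof -
    have "exp x * (1 + (y - x)) \<le> exp x * exp (y - x)"
      by (intro mult_left_mono exp_ge_add_one_self) auto
    also have "\<dots> = exp y" by (simp add: exp_add[symmetric])
    finally show ?thesis by (simp add: algebra_simps)
  qed
  then show ?thesis unfolding relent_eigen[OF K L] by (intro sum_nonneg mult_nonneg_nonneg) auto
qed

text \<open>The integrand is the derivative of the scalar entropy a ln (a/x) - a + x while x runs
  along the segment from a to b; at x = a this entropy is zero.\<close>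

lemma log_ratio_integral:
  fixes a b :: real
  assumes "a > 0" "b > 0"
  shows "((\<lambda>r. r * (a - b)\<^sup>2 / (r * b + (1 - r) * a)) has_integral (a * (ln a - ln b) - a + b)) {0..1}"
proof -
  let ?F = "\<lambda>r. (b - a) * r - a * ln (a + r * (b - a))"
  have pos: "a + r * (b - a) > 0" if "r \<in> {0..1}" for r
  proof -
    have "0 < (1 - r) * a + r * b"
      using that assms by (cases "r = 0") (auto intro!: add_nonneg_pos)
    then show ?thesis by (simp add: algebra_simps)
  qed
  have "(?F has_vector_derivative r * (a - b)\<^sup>2 / (r * b + (1 - r) * a)) (at r within {0..1})"
    if "r \<in> {0..1}" for r
  proof -
    have "(?F has_real_derivative (b - a) - a * ((b - a) / (a + r * (b - a)))) (at r within {0..1})"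
      using pos[OF that] by (auto intro!: derivative_eq_intros)
    moreover have "(b - a) - a * ((b - a) / (a + r * (b - a))) = r * (a - b)\<^sup>2 / (r * b + (1 - r) * a)"
    proof -
      have "r * b + (1 - r) * a = a + r * (b - a)" by (simp add: algebra_simps)
      then show ?thesis using pos[OF that] by (simp add: divide_simps) (simp add: power2_eq_square algebra_simps)
    qed
    ultimately show ?thesis by (simp add: has_real_derivative_iff_has_vector_derivative)
  qed
  from fundamental_theorem_of_calculus[OF zero_le_one this] show ?thesis
    using assms by (simp add: algebra_simps)
qed

text \<open>Linear in \<open>(T, B)\<close>; its supremum over \<open>Z\<close> is the integrand at \<open>r\<close> of the relative entropy
  of \<open>T\<close> and \<open>B\<close>.\<close>

definition relent_test :: "real \<Rightarrow> real^'d^'d \<Rightarrow> real^'d^'d \<Rightarrow> real^'d^'d \<Rightarrow> real" where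
  "relent_test r Z T B = r * (2 * (Z \<bullet> (T - B)) - r * (Z \<bullet> (Z ** B)) - (1 - r) * (Z \<bullet> (T ** Z)))"

text \<open>Left multiplication by \<open>T\<close> acts on the \<open>u\<close> side and right
  multiplication by \<open>B\<close> on the \<open>v\<close> side, so in the mixed coordinates of
  \<open>Z\<close> the functional decouples into one scalar quadratic for each pair (i, j).\<close>

lemma relent_test_eigen:
  assumes T: "eigenbasis T u a" and B: "eigenbasis B v b"
  shows "relent_test r Z T B = (\<Sum>i\<in>UNIV. \<Sum>j\<in>UNIV. r * (2 * (u i \<bullet> (Z *v v j)) * ((a i - b j) * (u i \<bullet> v j))
     - (u i \<bullet> (Z *v v j))\<^sup>2 * (r * b j + (1 - r) * a i)))"
proof -
  have u: "onb u" and v: "onb v" using T B by (auto simp: eigenbasis_def)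
  have Bv: "B *v v j = b j *\<^sub>R v j" for j using B by (auto simp: eigenbasis_def)
  note in1 = matrix_inner_onb[OF u v]
  show ?thesis
    unfolding relent_test_def in1 matrix_vector_mult_diff_rdistrib inner_diff_right
      matrix_vector_mul_assoc[symmetric] eigenbasis_inner_left[OF T] Bv matrix_vector_mult_scaleR inner_scaleR_right
      sum_distrib_left sum_subtractf[symmetric]
    by (intro sum.cong refl) (simp add: power2_eq_square algebra_simps)
qed

lemma quadratic_max:
  fixes z e D :: real
  assumes "D > 0" "r \<ge> 0"
  shows "r * (2 * z * e - z\<^sup>2 * D) \<le> r * e\<^sup>2 / D"
    and "z = e / D \<Longrightarrow> r * (2 * z * e - z\<^sup>2 * D) = r * e\<^sup>2 / D"
proof -
  have "2 * z * e - z\<^sup>2 * D = e\<^sup>2 / D - D * (z - e / D)\<^sup>2"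
    using assms by (simp add: field_simps power2_eq_square)
  moreover have "0 \<le> D * (z - e / D)\<^sup>2" using assms by simp
  ultimately have "2 * z * e - z\<^sup>2 * D \<le> e\<^sup>2 / D" by linarith
  then show "r * (2 * z * e - z\<^sup>2 * D) \<le> r * e\<^sup>2 / D"
    using mult_left_mono[OF _ assms(2)] by fastforce
  assume "z = e / D"
  then have "e = z * D" using assms by simp
  then show "r * (2 * z * e - z\<^sup>2 * D) = r * e\<^sup>2 / D"
    using assms by (simp add: power2_eq_square)
qed

lemma inner_matrix_mult_left:
  fixes Z B T :: "real^'d^'d"
  shows "Z \<bullet> (Z ** B) = (transpose Z ** Z) \<bullet> B" and "Z \<bullet> (T ** Z) = (Z ** transpose Z) \<bullet> T"
proof -
  have "Z \<bullet> (Z ** B) = (\<Sum>p\<in>UNIV. \<Sum>q\<in>UNIV. \<Sum>s\<in>UNIV. Z $ p $ q * (Z $ p $ s * B $ s $ q))"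
    by (simp add: inner_vec_def matrix_matrix_mult_def sum_distrib_left)
  also have "\<dots> = (\<Sum>s\<in>UNIV. \<Sum>q\<in>UNIV. \<Sum>p\<in>UNIV. Z $ p $ q * (Z $ p $ s * B $ s $ q))"
    by (subst sum.swap, subst (2) sum.swap, subst sum.swap) (rule refl)
  also have "\<dots> = (transpose Z ** Z) \<bullet> B"
    by (simp add: inner_vec_def matrix_matrix_mult_def transpose_def sum_distrib_left sum_distrib_right mult_ac)
  finally show "Z \<bullet> (Z ** B) = (transpose Z ** Z) \<bullet> B" .
  have "Z \<bullet> (T ** Z) = (\<Sum>p\<in>UNIV. \<Sum>q\<in>UNIV. \<Sum>s\<in>UNIV. Z $ p $ q * (T $ p $ s * Z $ s $ q))"
    by (simp add: inner_vec_def matrix_matrix_mult_def sum_distrib_left)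
  also have "\<dots> = (\<Sum>p\<in>UNIV. \<Sum>s\<in>UNIV. \<Sum>q\<in>UNIV. Z $ p $ q * (T $ p $ s * Z $ s $ q))"
    by (subst (2) sum.swap) (rule refl)
  also have "\<dots> = (Z ** transpose Z) \<bullet> T"
    by (simp add: inner_vec_def matrix_matrix_mult_def transpose_def sum_distrib_left sum_distrib_right mult_ac)
  finally show "Z \<bullet> (T ** Z) = (Z ** transpose Z) \<bullet> T" .
qed

lemma relent_supporting_functional:
  fixes K0 L0 :: "real^'d^'d"
  assumes "symmetric_matrix K0" "symmetric_matrix L0"
  obtains P N :: "real^'d^'d"
  where "\<And>K L. symmetric_matrix K \<Longrightarrow> symmetric_matrix L \<Longrightarrow> P \<bullet> mexp K - N \<bullet> mexp L \<le> relent K L"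
    and "P \<bullet> mexp K0 - N \<bullet> mexp L0 = relent K0 L0"
proof -
  obtain u k where K0: "eigenbasis K0 u k" using spectral_theorem[OF assms(1)] .
  obtain v l where L0: "eigenbasis L0 v l" using spectral_theorem[OF assms(2)] .
  have u: "onb u" and v: "onb v" using K0 L0 by (auto simp: eigenbasis_def)
  \<comment> \<open>The vertex of the scalar quadratic of each pair (i, j) at the prescribed point.
    \<open>Z r\<close> is then assembled to have exactly these mixed coordinates.\<close>
  define z where "z = (\<lambda>i j r. (exp (k i) - exp (l j)) * (u i \<bullet> v j) / (r * exp (l j) + (1 - r) * exp (k i)))"
  define Z :: "real \<Rightarrow> real^'d^'d" where
    "Z = (\<lambda>r. \<chi> p q. \<Sum>i\<in>UNIV. \<Sum>j\<in>UNIV. z i j r * (u i $ p * v j $ q))"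
  have pos: "r * b + (1 - r) * a > 0" if "r \<in> {0..1}" "a > 0" "b > 0" for r a b :: real
    using that by (cases "r = 0") (auto intro!: add_pos_nonneg)
  have Zuv: "u i \<bullet> (Z r *v v j) = z i j r" for i j r
  proof -
    have "Z r *v v j = (\<Sum>i\<in>UNIV. \<Sum>j'\<in>UNIV. (z i j' r * (v j' \<bullet> v j)) *\<^sub>R u i)"
    proof (subst vec_eq_iff, rule allI)
      fix p
      have "(Z r *v v j) $ p = (\<Sum>q\<in>UNIV. \<Sum>i\<in>UNIV. \<Sum>j'\<in>UNIV. z i j' r * (u i $ p * v j' $ q) * v j $ q)"
        by (simp add: Z_def matrix_vector_mult_def sum_distrib_right)
      also have "\<dots> = (\<Sum>i\<in>UNIV. \<Sum>j'\<in>UNIV. \<Sum>q\<in>UNIV. z i j' r * (u i $ p * v j' $ q) * v j $ q)"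
        by (subst sum.swap, subst (2) sum.swap) (rule refl)
      also have "\<dots> = (\<Sum>i\<in>UNIV. \<Sum>j'\<in>UNIV. (z i j' r * (v j' \<bullet> v j)) *\<^sub>R u i) $ p"
        by (simp add: inner_vec_def sum_distrib_left sum_distrib_right mult_ac)
      finally show "(Z r *v v j) $ p = (\<Sum>i\<in>UNIV. \<Sum>j'\<in>UNIV. (z i j' r * (v j' \<bullet> v j)) *\<^sub>R u i) $ p" .
    qed
    also have "\<dots> = (\<Sum>i\<in>UNIV. z i j r *\<^sub>R u i)"
      by (simp add: onb_inner[OF v] if_distrib if_distribR cong: if_cong)
    finally show ?thesis
      by (simp add: inner_sum_right onb_inner[OF u] if_distrib cong: if_cong)
  qed
  have contz: "continuous_on {0..1} (z i j)" for i j
    unfolding z_def by (intro continuous_intros) (use pos[of _ "exp (k i)" "exp (l j)"] in force)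
  have contZ: "continuous_on {0..1} (\<lambda>r. Z r $ p $ q)" for p q
    unfolding Z_def vec_lambda_beta by (intro continuous_intros contz)
  \<comment> \<open>\<open>P1 r\<close> and \<open>- N1 r\<close> are the coefficients of
    \<open>T\<close> and \<open>B\<close> in \<open>relent_test r (Z r) T B\<close>; integrating
    them over r produces the functional.\<close>
  define P1 where "P1 = (\<lambda>r. r *\<^sub>R (2 *\<^sub>R Z r - (1 - r) *\<^sub>R (Z r ** transpose (Z r))))"
  define N1 where "N1 = (\<lambda>r. r *\<^sub>R (2 *\<^sub>R Z r + r *\<^sub>R (transpose (Z r) ** Z r)))"
  have "continuous_on {0..1} P1" "continuous_on {0..1} N1"
    unfolding P1_def N1_def matrix_matrix_mult_def transpose_def
    by (intro continuous_intros continuous_on_vec_lambda continuous_on_scaleR continuous_on_diff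
         continuous_on_add contZ; simp add: Z_def; intro continuous_intros continuous_on_vec_lambda contz)+
  then have int: "P1 integrable_on {0..1}" "N1 integrable_on {0..1}"
    by (auto intro: integrable_continuous_interval)
  have test: "((\<lambda>r. relent_test r (Z r) T B) has_integral (integral {0..1} P1 \<bullet> T - integral {0..1} N1 \<bullet> B)) {0..1}"
    for T B
  proof -
    have "((\<lambda>r. P1 r \<bullet> T - N1 r \<bullet> B) has_integral (integral {0..1} P1 \<bullet> T - integral {0..1} N1 \<bullet> B)) {0..1}"
      using int[THEN integrable_integral]
      by (intro has_integral_diff has_integral_linear[OF _ bounded_linear_inner_left, unfolded o_def])
    moreover have "P1 r \<bullet> T - N1 r \<bullet> B = relent_test r (Z r) T B" for r
      unfolding P1_def N1_def relent_test_def inner_matrix_mult_left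
      by (simp add: inner_diff_left inner_diff_right inner_add_left algebra_simps)
    ultimately show ?thesis by simp
  qed
  \<comment> \<open>The eigendata are bound afresh here: the representation serves both an arbitrary
    pair and the prescribed pair (\<open>K0\<close>, \<open>L0\<close>).\<close>
  have relent: "((\<lambda>r. \<Sum>i\<in>UNIV. \<Sum>j\<in>UNIV. r * ((exp (k i) - exp (l j)) * (u i \<bullet> v j))\<^sup>2 /
      (r * exp (l j) + (1 - r) * exp (k i))) has_integral relent K L) {0..1}"
    if K: "eigenbasis K u k" and L: "eigenbasis L v l" for K L :: "real^'d^'d" and u v k l
    unfolding relent_eigen[OF K L]
  proof (intro has_integral_sum finite_UNIV)
    fix i j
    show "((\<lambda>r. r * ((exp (k i) - exp (l j)) * (u i \<bullet> v j))\<^sup>2 / (r * exp (l j) + (1 - r) * exp (k i)))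
       has_integral (u i \<bullet> v j)\<^sup>2 * (exp (k i) * (k i - l j) - exp (k i) + exp (l j))) {0..1}"
      using has_integral_mult_right[OF log_ratio_integral[of "exp (k i)" "exp (l j)"], of "(u i \<bullet> v j)\<^sup>2"]
      by (simp add: power_mult_distrib mult_ac)
  qed simp_all
  show thesis
  proof
    fix K L :: "real^'d^'d" assume sym: "symmetric_matrix K" "symmetric_matrix L"
    obtain u k where K: "eigenbasis K u k" using spectral_theorem[OF sym(1)] .
    obtain v l where L: "eigenbasis L v l" using spectral_theorem[OF sym(2)] .
    show "integral {0..1} P1 \<bullet> mexp K - integral {0..1} N1 \<bullet> mexp L \<le> relent K L"
    proof (rule has_integral_le[OF test relent[OF K L]])
      fix r :: real assume r: "r \<in> {0..1}"
      show "relent_test r (Z r) (mexp K) (mexp L) \<le> (\<Sum>i\<in>UNIV. \<Sum>j\<in>UNIV.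
        r * ((exp (k i) - exp (l j)) * (u i \<bullet> v j))\<^sup>2 / (r * exp (l j) + (1 - r) * exp (k i)))"
        unfolding relent_test_eigen[OF mexp_eigenbasis[OF K] mexp_eigenbasis[OF L]]
        using r by (intro sum_mono quadratic_max(1) pos) auto
    qed
  next
    show "integral {0..1} P1 \<bullet> mexp K0 - integral {0..1} N1 \<bullet> mexp L0 = relent K0 L0"
    proof (rule has_integral_unique[OF test has_integral_eq[OF _ relent[OF K0 L0]]])
      fix r :: real assume r: "r \<in> {0..1}"
      show "(\<Sum>i\<in>UNIV. \<Sum>j\<in>UNIV. r * ((exp (k i) - exp (l j)) * (u i \<bullet> v j))\<^sup>2 /
        (r * exp (l j) + (1 - r) * exp (k i))) = relent_test r (Z r) (mexp K0) (mexp L0)"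
        unfolding relent_test_eigen[OF mexp_eigenbasis[OF K0] mexp_eigenbasis[OF L0]] Zuv
        using r by (intro sum.cong refl quadratic_max(2)[symmetric] pos) (auto simp: z_def)
    qed
  qed
qed

section \<open>Lieb's theorem in expectation form\<close>

lemma symmetric_matrix_add:
  "symmetric_matrix A \<Longrightarrow> symmetric_matrix B \<Longrightarrow> symmetric_matrix (A + B)"
  by (simp add: symmetric_matrix_def transpose_def vec_eq_iff)

lemma symmetric_matrix_scaleR:
  "symmetric_matrix A \<Longrightarrow> symmetric_matrix (c *\<^sub>R A)"
  by (simp add: symmetric_matrix_def transpose_def vec_eq_iff)

lemma symmetric_matrix_mat: "symmetric_matrix (mat c)"
  by (simp add: symmetric_matrix_def)

lemma eigenbasis_inner:
  assumes "eigenbasis A u a"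
  shows "A \<bullet> W = (\<Sum>i\<in>UNIV. a i * (u i \<bullet> (W *v u i)))"
proof -
  have u: "onb u" using assms by (simp add: eigenbasis_def)
  show ?thesis
    unfolding matrix_inner_onb[OF u u] eigenbasis_inner_left[OF assms] onb_inner[OF u]
    by (simp add: if_distrib if_distribR cong: if_cong)
qed

text \<open>Klein's inequality for (L, V) bounds the difference of the traces by
  \<open>mexp L \<bullet> (L - V)\<close>, which is nonpositive termwise in an eigenbasis of
  \<open>L\<close>. The exponential itself is not operator monotone; only its trace is.\<close>

lemma trace_mexp_mono:
  fixes L V :: "real^'d^'d"
  assumes L: "symmetric_matrix L" and V: "symmetric_matrix V" and le: "\<And>x. x \<bullet> (L *v x) \<le> x \<bullet> (V *v x)"
  shows "trace (mexp L) \<le> trace (mexp V)"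
proof -
  obtain u l where e: "eigenbasis L u l" using spectral_theorem[OF L] .
  have "mexp L \<bullet> (L - V) \<le> 0"
    unfolding inner_diff_right eigenbasis_inner[OF mexp_eigenbasis[OF e]]
    using le by (auto intro!: sum_mono)
  then show ?thesis using relent_nonneg[OF L V] by (simp add: relent_def)
qed

text \<open>A crude comparison of \<open>H\<close> with a multiple of the identity. It supplies the
  integrable majorant for exponentials shifted by a fixed \<open>H\<close>.\<close>

lemma trace_mexp_add_le:
  fixes H X :: "real^'d^'d"
  assumes "symmetric_matrix H" "symmetric_matrix X"
  shows "trace (mexp (H + X)) \<le> exp (lambda_max H) * trace (mexp X)"
proof -
  have "trace (mexp (H + X)) \<le> trace (mexp (lambda_max H *\<^sub>R mat 1 + X))"
  proof (rule trace_mexp_mono)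
    show "x \<bullet> ((H + X) *v x) \<le> x \<bullet> ((lambda_max H *\<^sub>R mat 1 + X) *v x)" for x
      using quadratic_le_lambda_max[OF assms(1), of x]
      by (simp add: matrix_vector_mult_add_rdistrib inner_add_right scaleR_matrix_vector_assoc[symmetric])
  qed (intro symmetric_matrix_add symmetric_matrix_scaleR symmetric_matrix_mat assms)+
  also have "\<dots> = exp (lambda_max H) * trace (mexp X)"
    by (simp add: mexp_shift[OF assms(2)] trace_def sum_distrib_left)
  finally show ?thesis .
qed

lemma trace_mexp_le_lambda_max:
  fixes X :: "real^'d^'d"
  assumes "symmetric_matrix X"
  shows "trace (mexp X) \<le> real CARD('d) * exp (lambda_max X)"
proof -
  obtain u a where e: "eigenbasis X u a" using spectral_theorem[OF assms] .
  have "(\<Sum>i\<in>UNIV. exp (a i)) \<le> (\<Sum>i\<in>(UNIV :: 'd set). exp (lambda_max X))"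
    by (intro sum_mono) (simp add: eigenbasis_lambda_max[OF e])
  then show ?thesis by (simp add: mexp_trace[OF e])
qed

lemma exp_lambda_max_le_trace:
  fixes X :: "real^'d^'d"
  assumes "symmetric_matrix X"
  shows "exp (lambda_max X) \<le> trace (mexp X)"
proof -
  obtain u a where e: "eigenbasis X u a" using spectral_theorem[OF assms] .
  have "Max (range a) \<in> range a" by (intro Max_in) auto
  then obtain i where "lambda_max X = a i" using eigenbasis_lambda_max[OF e] by (metis imageE)
  then show ?thesis
    unfolding mexp_trace[OF e] by (simp add: member_le_sum[of i UNIV "\<lambda>i. exp (a i)"])
qed

text \<open>The Frobenius norm is the l2 norm of the positive eigenvalues and the trace their l1
  norm. Integrability of a matrix exponential is thereby reduced to that of a scalar.\<close>

lemma norm_mexp_le_trace: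
  fixes X :: "real^'d^'d"
  assumes "symmetric_matrix X"
  shows "norm (mexp X) \<le> trace (mexp X)"
proof -
  obtain u a where e: "eigenbasis X u a" using spectral_theorem[OF assms] .
  then have u: "onb u" by (simp add: eigenbasis_def)
  have ev: "mexp X *v u i = exp (a i) *\<^sub>R u i" for i using mexp_eigenbasis[OF e] by (simp add: eigenbasis_def)
  have "(norm (mexp X))\<^sup>2 = (\<Sum>i\<in>UNIV. (exp (a i))\<^sup>2)"
    unfolding power2_norm_eq_inner eigenbasis_inner[OF mexp_eigenbasis[OF e]] ev
    by (simp add: onb_inner[OF u] power2_eq_square)
  also have "\<dots> \<le> (\<Sum>i\<in>UNIV. exp (a i))\<^sup>2"
    unfolding power2_eq_square sum_product
    by (intro sum_mono member_le_sum) auto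
  finally show ?thesis
    unfolding mexp_trace[OF e] by (rule power2_le_imp_le) (simp add: sum_nonneg)
qed

lemma bilinear_eq_inner:
  fixes A :: "real^'d^'d"
  shows "x \<bullet> (A *v y) = A \<bullet> (\<chi> i k. x $ i * y $ k)"
  by (simp add: inner_vec_def matrix_vector_mult_def sum_distrib_left mult_ac)

lemma integral_bilinear:
  fixes T :: "'a \<Rightarrow> real^'d^'d"
  assumes "integrable M T"
  shows "x \<bullet> (integral\<^sup>L M T *v y) = (\<integral>\<omega>. x \<bullet> (T \<omega> *v y) \<partial>M)"
    and "integrable M (\<lambda>\<omega>. x \<bullet> (T \<omega> *v y))"
  unfolding bilinear_eq_inner using assms by simp_all

lemma symmetric_matrix_integral:
  fixes T :: "'a \<Rightarrow> real^'d^'d"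
  assumes "integrable M T" "\<And>\<omega>. symmetric_matrix (T \<omega>)"
  shows "symmetric_matrix (integral\<^sup>L M T)"
proof (rule symmetric_matrixI)
  fix x y
  have "x \<bullet> (T \<omega> *v y) = y \<bullet> (T \<omega> *v x)" for \<omega>
    using symmetric_matrix_inner[OF assms(2)] inner_commute by metis
  then show "x \<bullet> (integral\<^sup>L M T *v y) = (integral\<^sup>L M T *v x) \<bullet> y"
    by (subst inner_commute) (simp add: integral_bilinear(1)[OF assms(1)])
qed

text \<open>Jensen's inequality for the entropy of the random pair (H + X, X) is combined with the
  Gibbs variational principle: tr e^(H+L) dominates tr T + T . (H + L - log T) for every positive
  definite T, here the mean of e^(H+X).\<close>

theorem (in prob_space) lieb_jensen:
  fixes X :: "'a \<Rightarrow> real^'d^'d"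
  assumes sym: "\<And>\<omega>. symmetric_matrix (X \<omega>)" "symmetric_matrix H" "symmetric_matrix L"
    and int: "integrable M (\<lambda>\<omega>. mexp (X \<omega>))" and X [measurable]: "X \<in> borel_measurable M"
    and L: "mexp L = expectation (\<lambda>\<omega>. mexp (X \<omega>))"
  shows "integrable M (\<lambda>\<omega>. trace (mexp (H + X \<omega>)))"
    and "expectation (\<lambda>\<omega>. trace (mexp (H + X \<omega>))) \<le> trace (mexp (H + L))"
proof -
  define T where "T = (\<lambda>\<omega>. mexp (H + X \<omega>))"
  have symHX: "symmetric_matrix (H + X \<omega>)" for \<omega> using sym symmetric_matrix_add by blast
  have trint: "integrable M (\<lambda>\<omega>. trace (mexp (X \<omega>)))"
    unfolding trace_inner_mat using int by simp
  have T: "integrable M T"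
  proof (rule Bochner_Integration.integrable_bound[OF integrable_mult_right[OF trint, of "exp (lambda_max H)"]])
    show "T \<in> borel_measurable M" unfolding T_def by measurable
    show "AE \<omega> in M. norm (T \<omega>) \<le> norm (exp (lambda_max H) * trace (mexp (X \<omega>)))"
      using norm_mexp_le_trace[OF symHX] trace_mexp_add_le[OF sym(2,1)]
      unfolding T_def by (intro AE_I2) (smt (verit) real_norm_def)
  qed
  then show "integrable M (\<lambda>\<omega>. trace (mexp (H + X \<omega>)))"
    unfolding trace_inner_mat by (simp add: T_def)
  define Tb where "Tb = expectation T"
  have "symmetric_matrix Tb"
    unfolding Tb_def by (rule symmetric_matrix_integral[OF T]) (simp add: T_def mexp_symmetric symHX)
  moreover have "0 < x \<bullet> (Tb *v x)" if "x \<noteq> 0" for x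
    unfolding Tb_def integral_bilinear(1)[OF T]
    by (rule expectation_greater[OF integral_bilinear(2)[OF T]])
       (simp add: T_def mexp_posdef[OF symHX that])
  \<comment> \<open>The functional is chosen to touch the entropy at the pair of means,
    \<open>Tb = mexp K\<close> and \<open>mexp L\<close>.\<close>
  ultimately obtain K where K: "symmetric_matrix K" "mexp K = Tb" by (rule posdef_log)
  obtain P N where le: "\<And>K L. symmetric_matrix K \<Longrightarrow> symmetric_matrix L \<Longrightarrow> P \<bullet> mexp K - N \<bullet> mexp L \<le> relent K L"
    and eq: "P \<bullet> mexp K - N \<bullet> mexp L = relent K L"
    using relent_supporting_functional[OF K(1) sym(3)] by blast
  have "P \<bullet> mexp K - N \<bullet> mexp L = expectation (\<lambda>\<omega>. P \<bullet> T \<omega> - N \<bullet> mexp (X \<omega>))"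
    using T int by (simp add: K L Tb_def)
  \<comment> \<open>The right-hand integrand is \<open>relent (H + X \<omega>) (X \<omega>)\<close>;
    the random logarithm has dropped out of the difference, leaving \<open>H\<close>.\<close>
  also have "\<dots> \<le> expectation (\<lambda>\<omega>. T \<omega> \<bullet> H - T \<omega> \<bullet> mat 1 + mexp (X \<omega>) \<bullet> mat 1)"
  proof (rule integral_mono)
    show "P \<bullet> T \<omega> - N \<bullet> mexp (X \<omega>) \<le> T \<omega> \<bullet> H - T \<omega> \<bullet> mat 1 + mexp (X \<omega>) \<bullet> mat 1" for \<omega>
      using le[OF symHX sym(1), of \<omega> \<omega>] by (simp add: relent_def T_def trace_inner_mat)
  qed (use T int in auto)
  also have "\<dots> = Tb \<bullet> H - trace Tb + trace (mexp L)"
    using T int by (simp add: L Tb_def trace_inner_mat)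
  finally have "Tb \<bullet> (K - L) \<le> Tb \<bullet> H"
    unfolding eq by (simp add: relent_def K)
  \<comment> \<open>By the preceding inequality the term \<open>Tb \<bullet> (K - L - H)\<close> of
    this entropy is nonpositive, which leaves the comparison of traces.\<close>
  moreover have "0 \<le> relent K (H + L)"
    using K sym by (intro relent_nonneg symmetric_matrix_add)
  ultimately have "trace Tb \<le> trace (mexp (H + L))"
    by (simp add: relent_def K inner_diff_right inner_add_right)
  moreover have "trace Tb = expectation (\<lambda>\<omega>. trace (mexp (H + X \<omega>)))"
    using T unfolding Tb_def trace_inner_mat by (simp add: T_def)
  ultimately show "expectation (\<lambda>\<omega>. trace (mexp (H + X \<omega>))) \<le> trace (mexp (H + L))" by simp
qed

section \<open>Gaussian integration by parts\<close>

text \<open>For even n the quotient of factorials is the double factorial (n-1)!!. Since 0^0 = 1,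
  the formula also gives the moments of the point mass at v = 0.\<close>

definition gaussian_moment :: "nat \<Rightarrow> real \<Rightarrow> real" where
  "gaussian_moment n v = (if even n then fact n / (2 ^ (n div 2) * fact (n div 2)) * v ^ (n div 2) else 0)"

lemma normal_law_moment:
  assumes "v \<ge> 0"
  shows "integrable (normal_law 0 v) (\<lambda>x. x ^ n)"
    and "(\<integral>x. x ^ n \<partial>normal_law 0 v) = gaussian_moment n v"
    and "integrable (normal_law 0 v) (\<lambda>x. \<bar>x\<bar> ^ n)"
proof -
  have "integrable (normal_law 0 v) (\<lambda>x. x ^ n) \<and> (\<integral>x. x ^ n \<partial>normal_law 0 v) = gaussian_moment n v
    \<and> integrable (normal_law 0 v) (\<lambda>x. \<bar>x\<bar> ^ n)"
  proof (cases "v = 0")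
    case True
    have "integrable (return borel (0 :: real)) (\<lambda>x. x ^ n)" "integrable (return borel (0 :: real)) (\<lambda>x. \<bar>x\<bar> ^ n)"
      by (simp_all add: integrable_iff_bounded nn_integral_return)
    moreover have "(\<integral>x. x ^ n \<partial>return borel (0 :: real)) = 0 ^ n"
      by (rule integral_return) auto
    moreover have "gaussian_moment n 0 = 0 ^ n"
      by (auto simp: gaussian_moment_def power_0_left dvd_div_eq_0_iff)
    ultimately show ?thesis using True
      by (simp add: normal_law_def)
  next
    case False
    then have s: "sqrt v > 0" and v: "v > 0" using assms by auto
    have "(\<integral>x. normal_density 0 (sqrt v) x * x ^ n \<partial>lborel) = gaussian_moment n v"
    proof (cases "even n")
      case True
      then obtain k where k: "n = 2 * k" by (auto elim: evenE)
      show ?thesis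
        using integral_normal_moment_even[OF s, of 0 k] v
        by (simp add: k gaussian_moment_def power_divide)
    next
      case False
      then obtain k where k: "n = 2 * k + 1" by (auto elim: oddE)
      show ?thesis using integral_normal_moment_odd[OF s, of 0 k] False
        by (simp add: k gaussian_moment_def)
    qed
    then show ?thesis
      using integrable_normal_moment[OF s, of 0 n] integrable_normal_moment_abs[OF s, of 0 n] False
      by (simp add: normal_law_def integrable_real_density integral_real_density)
  qed
  then show "integrable (normal_law 0 v) (\<lambda>x. x ^ n)"
    "(\<integral>x. x ^ n \<partial>normal_law 0 v) = gaussian_moment n v"
    "integrable (normal_law 0 v) (\<lambda>x. \<bar>x\<bar> ^ n)" by auto
qed

text \<open>A class closed under sums, products and powers whose members are integrable against a
  Gaussian law, so that integrability of every polynomial expression follows from its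
  syntax.\<close>

definition poly_growth :: "('a::euclidean_space \<Rightarrow> real) \<Rightarrow> bool" where
  "poly_growth F \<longleftrightarrow> F \<in> borel_measurable borel \<and> (\<exists>C N. \<forall>y. \<bar>F y\<bar> \<le> C * (1 + norm y) ^ N)"

lemma poly_growthI:
  "F \<in> borel_measurable borel \<Longrightarrow> (\<And>y. \<bar>F y\<bar> \<le> C * (1 + norm y) ^ N) \<Longrightarrow> poly_growth F"
  unfolding poly_growth_def by blast

lemma poly_growth_const: "poly_growth (\<lambda>_. c)"
  by (rule poly_growthI[of _ "\<bar>c\<bar>" 0]) auto

lemma poly_growth_inner: "poly_growth (\<lambda>y. u \<bullet> y)"
proof (rule poly_growthI[of _ "norm u" 1])
  show "\<bar>u \<bullet> y\<bar> \<le> norm u * (1 + norm y) ^ 1" for y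
    using Cauchy_Schwarz_ineq2[of u y] by (simp add: distrib_left add_increasing)
qed auto

lemma poly_growth_mult:
  assumes "poly_growth F" "poly_growth G"
  shows "poly_growth (\<lambda>y. F y * G y)"
proof -
  obtain C N where F: "F \<in> borel_measurable borel" "\<And>y. \<bar>F y\<bar> \<le> C * (1 + norm y) ^ N"
    using assms(1) unfolding poly_growth_def by blast
  obtain D K where G: "G \<in> borel_measurable borel" "\<And>y. \<bar>G y\<bar> \<le> D * (1 + norm y) ^ K"
    using assms(2) unfolding poly_growth_def by blast
  show ?thesis
  proof (rule poly_growthI)
    show "(\<lambda>y. F y * G y) \<in> borel_measurable borel" using F(1) G(1) by simp
    show "\<bar>F y * G y\<bar> \<le> (C * D) * (1 + norm y) ^ (N + K)" for y
      using mult_mono'[OF F(2)[of y] G(2)[of y]] by (simp add: abs_mult power_add mult_ac)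
  qed
qed

lemma poly_growth_add:
  assumes "poly_growth F" "poly_growth G"
  shows "poly_growth (\<lambda>y. F y + G y)"
proof -
  obtain C N where F: "F \<in> borel_measurable borel" "\<And>y. \<bar>F y\<bar> \<le> C * (1 + norm y) ^ N"
    using assms(1) unfolding poly_growth_def by blast
  obtain D K where G: "G \<in> borel_measurable borel" "\<And>y. \<bar>G y\<bar> \<le> D * (1 + norm y) ^ K"
    using assms(2) unfolding poly_growth_def by blast
  show ?thesis
  proof (rule poly_growthI)
    show "(\<lambda>y. F y + G y) \<in> borel_measurable borel" using F(1) G(1) by simp
    show "\<bar>F y + G y\<bar> \<le> (\<bar>C\<bar> + \<bar>D\<bar>) * (1 + norm y) ^ (N + K)" for y
    proof -
      have p: "(1 + norm y) ^ N \<le> (1 + norm y) ^ (N + K)" "(1 + norm y) ^ K \<le> (1 + norm y) ^ (N + K)"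
        by (auto intro!: power_increasing)
      have "C * (1 + norm y) ^ N \<le> \<bar>C\<bar> * (1 + norm y) ^ (N + K)"
        by (intro mult_mono p) auto
      moreover have "D * (1 + norm y) ^ K \<le> \<bar>D\<bar> * (1 + norm y) ^ (N + K)"
        by (intro mult_mono p) auto
      ultimately show ?thesis using F(2)[of y] G(2)[of y] by (simp add: distrib_right)
    qed
  qed
qed

lemma poly_growth_power: "poly_growth F \<Longrightarrow> poly_growth (\<lambda>y. F y ^ n)"
  by (induction n) (simp_all add: poly_growth_const poly_growth_mult)

lemma poly_growth_sum: "(\<And>i. i \<in> I \<Longrightarrow> poly_growth (F i)) \<Longrightarrow> poly_growth (\<lambda>y. \<Sum>i\<in>I. F i y)"
  by (induction I rule: infinite_finite_induct) (auto simp: poly_growth_const poly_growth_add)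

lemma poly_growth_inner_self: "poly_growth (\<lambda>y. y \<bullet> y)"
  using poly_growth_sum[of Basis "\<lambda>b y. (b \<bullet> y) * (b \<bullet> y)"]
  by (subst euclidean_inner) (simp add: poly_growth_mult poly_growth_inner inner_commute)

lemmas poly_growth_intros = poly_growth_const poly_growth_inner poly_growth_mult poly_growth_add
  poly_growth_power poly_growth_inner_self poly_growth_sum

section \<open>Moments of a centred Gaussian vector with possibly singular covariance\<close>

locale centered_gaussian = prob_space M for M :: "'a measure" +
  fixes Y :: "'a \<Rightarrow> real^'d" and S :: "real^'d^'d"
  assumes gaussian: "gaussian_vector M Y 0 S"
    and sym: "symmetric_matrix S" and psd: "pos_semidef S"
begin

lemma measurable_Y [measurable]: "Y \<in> borel_measurable M"
  using gaussian by (simp add: gaussian_vector_def)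

lemma expectation_linear_power:
  shows "integrable M (\<lambda>\<omega>. \<bar>u \<bullet> Y \<omega>\<bar> ^ n)"
    and "expectation (\<lambda>\<omega>. (u \<bullet> Y \<omega>) ^ n) = gaussian_moment n (u \<bullet> (S *v u))"
proof -
  have v: "u \<bullet> (S *v u) \<ge> 0" using psd by (simp add: pos_semidef_def)
  have d: "distr M borel (\<lambda>\<omega>. u \<bullet> Y \<omega>) = normal_law 0 (u \<bullet> (S *v u))"
    using gaussian by (simp add: gaussian_vector_def)
  show "integrable M (\<lambda>\<omega>. \<bar>u \<bullet> Y \<omega>\<bar> ^ n)"
    using normal_law_moment(3)[OF v, of n] unfolding d[symmetric]
    by (subst (asm) integrable_distr_eq) auto
  show "expectation (\<lambda>\<omega>. (u \<bullet> Y \<omega>) ^ n) = gaussian_moment n (u \<bullet> (S *v u))"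
    using normal_law_moment(2)[OF v, of n] unfolding d[symmetric]
    by (subst (asm) integral_distr) auto
qed

lemma integrable_norm_power: "integrable M (\<lambda>\<omega>. norm (Y \<omega>) ^ n)"
proof (rule Bochner_Integration.integrable_bound)
  show "integrable M (\<lambda>\<omega>. real CARD('d) ^ n * (\<Sum>i\<in>UNIV. \<bar>axis i 1 \<bullet> Y \<omega>\<bar> ^ n))"
    by (intro integrable_mult_right Bochner_Integration.integrable_sum expectation_linear_power)
  have "norm y ^ n \<le> real CARD('d) ^ n * (\<Sum>i\<in>UNIV. \<bar>axis i 1 \<bullet> y\<bar> ^ n)" for y :: "real^'d"
  proof -
    \<comment> \<open>Comparing with the largest coordinate, rather than the sum, makes the n-th
      power a single term of the sum of n-th powers.\<close>
    have "Max (range (\<lambda>i. \<bar>y $ i\<bar>)) \<in> range (\<lambda>i. \<bar>y $ i\<bar>)" by (intro Max_in) auto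
    then obtain i where i: "Max (range (\<lambda>i. \<bar>y $ i\<bar>)) = \<bar>y $ i\<bar>" by (metis imageE)
    have "\<bar>y $ j\<bar> \<le> \<bar>y $ i\<bar>" for j unfolding i[symmetric] by (intro Max_ge) auto
    then have "(\<Sum>j\<in>UNIV. \<bar>y $ j\<bar>) \<le> (\<Sum>j\<in>(UNIV :: 'd set). \<bar>y $ i\<bar>)" by (intro sum_mono)
    then have "norm y \<le> real CARD('d) * \<bar>y $ i\<bar>" using norm_le_l1_cart[of y] by simp
    then have "norm y ^ n \<le> (real CARD('d) * \<bar>y $ i\<bar>) ^ n" by (intro power_mono) auto
    also have "\<dots> \<le> real CARD('d) ^ n * (\<Sum>i\<in>UNIV. \<bar>y $ i\<bar> ^ n)"
      unfolding power_mult_distrib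
      by (intro mult_left_mono member_le_sum[of i UNIV "\<lambda>i. \<bar>y $ i\<bar> ^ n"]) auto
    finally show ?thesis by (simp add: inner_axis')
  qed
  then show "AE \<omega> in M. norm (norm (Y \<omega>) ^ n) \<le> norm (real CARD('d) ^ n * (\<Sum>i\<in>UNIV. \<bar>axis i 1 \<bullet> Y \<omega>\<bar> ^ n))"
    by (intro AE_I2) (simp add: order_trans[OF _ abs_ge_self])
qed simp

lemma integrable_poly_growth:
  assumes "poly_growth F"
  shows "integrable M (\<lambda>\<omega>. F (Y \<omega>))"
proof -
  obtain C N where [measurable]: "F \<in> borel_measurable borel" and F: "\<And>y. \<bar>F y\<bar> \<le> C * (1 + norm y) ^ N"
    using assms unfolding poly_growth_def by blast
  have "integrable M (\<lambda>\<omega>. C * (\<Sum>k\<le>N. of_nat (N choose k) * norm (Y \<omega>) ^ (N - k)))"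
    by (intro integrable_mult_right Bochner_Integration.integrable_sum integrable_norm_power)
  then have int: "integrable M (\<lambda>\<omega>. C * (1 + norm (Y \<omega>)) ^ N)"
    by (simp add: binomial_ring)
  show ?thesis
  proof (rule Bochner_Integration.integrable_bound[OF int])
    show "AE \<omega> in M. norm (F (Y \<omega>)) \<le> norm (C * (1 + norm (Y \<omega>)) ^ N)"
      using F by (intro AE_I2) (metis abs_ge_self order_trans real_norm_def)
  qed measurable
qed

text \<open>By the binomial theorem the expectation is a polynomial in e, so differentiation under
  the integral is just reading off the linear coefficient.\<close>

lemma deriv_expectation:
  assumes F: "poly_growth F"
  shows "((\<lambda>e. expectation (\<lambda>\<omega>. ((u + e *\<^sub>R w) \<bullet> Y \<omega>) ^ n * F (Y \<omega>))) has_real_derivative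
    n * expectation (\<lambda>\<omega>. (u \<bullet> Y \<omega>) ^ (n - 1) * ((w \<bullet> Y \<omega>) * F (Y \<omega>)))) (at 0)"
proof -
  define c where "c = (\<lambda>k. of_nat (n choose k) * expectation (\<lambda>\<omega>. (w \<bullet> Y \<omega>) ^ k * (u \<bullet> Y \<omega>) ^ (n - k) * F (Y \<omega>)))"
  have eq: "expectation (\<lambda>\<omega>. ((u + e *\<^sub>R w) \<bullet> Y \<omega>) ^ n * F (Y \<omega>)) = (\<Sum>k\<le>n. c k * e ^ k)" for e
  proof -
    have "(\<lambda>\<omega>. ((u + e *\<^sub>R w) \<bullet> Y \<omega>) ^ n * F (Y \<omega>)) = (\<lambda>\<omega>. \<Sum>k\<le>n. (of_nat (n choose k) * e ^ k) *
        ((w \<bullet> Y \<omega>) ^ k * (u \<bullet> Y \<omega>) ^ (n - k) * F (Y \<omega>)))"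
    proof
      fix \<omega>
      have uw: "(u + e *\<^sub>R w) \<bullet> Y \<omega> = e * (w \<bullet> Y \<omega>) + u \<bullet> Y \<omega>" by (simp add: inner_add_left)
      show "((u + e *\<^sub>R w) \<bullet> Y \<omega>) ^ n * F (Y \<omega>) = (\<Sum>k\<le>n. (of_nat (n choose k) * e ^ k) *
        ((w \<bullet> Y \<omega>) ^ k * (u \<bullet> Y \<omega>) ^ (n - k) * F (Y \<omega>)))"
        unfolding uw binomial_ring sum_distrib_right
        by (intro sum.cong refl) (simp add: power_mult_distrib mult_ac)
    qed
    moreover have "integrable M (\<lambda>\<omega>. (w \<bullet> Y \<omega>) ^ k * (u \<bullet> Y \<omega>) ^ (n - k) * F (Y \<omega>))" for k
      by (rule integrable_poly_growth) (intro poly_growth_intros F)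
    ultimately have "expectation (\<lambda>\<omega>. ((u + e *\<^sub>R w) \<bullet> Y \<omega>) ^ n * F (Y \<omega>)) = (\<Sum>k\<le>n. (of_nat (n choose k) * e ^ k) *
        expectation (\<lambda>\<omega>. (w \<bullet> Y \<omega>) ^ k * (u \<bullet> Y \<omega>) ^ (n - k) * F (Y \<omega>)))"
      by simp
    then show ?thesis by (simp only: c_def mult_ac)
  qed
  have "((\<lambda>e. \<Sum>k\<le>n. c k * e ^ k) has_real_derivative (\<Sum>k\<le>n. c k * (k * 0 ^ (k - 1)))) (at 0)"
    by (auto intro!: derivative_eq_intros sum.cong)
  \<comment> \<open>At k = 0 truncated subtraction gives 0^0 = 1, but the factor k removes that
    term; only k = 1 survives.\<close>
  also have "(\<Sum>k\<le>n. c k * (k * 0 ^ (k - 1))) = (\<Sum>k\<le>n. if k = 1 then c k else 0)"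
    by (intro sum.cong) (auto simp: power_0_left)
  also have "\<dots> = n * expectation (\<lambda>\<omega>. (u \<bullet> Y \<omega>) ^ (n - 1) * ((w \<bullet> Y \<omega>) * F (Y \<omega>)))"
    by (cases n) (simp_all add: c_def mult_ac)
  finally show ?thesis unfolding eq .
qed

text \<open>\<open>F'\<close> is the derivative of \<open>F\<close> in the direction \<open>S z\<close>. The extra power \<open>(u \<bullet> y)\<^sup>n\<close> is what
  makes the property stable under multiplying \<open>F\<close> by a linear form \<open>w \<bullet> y\<close>: differentiate in \<open>u\<close>
  along \<open>w\<close>.\<close>

definition ibp :: "real^'d \<Rightarrow> (real^'d \<Rightarrow> real) \<Rightarrow> (real^'d \<Rightarrow> real) \<Rightarrow> bool" where
  "ibp z F F' \<longleftrightarrow> poly_growth F \<and> poly_growth F' \<and>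
    (\<forall>n u. expectation (\<lambda>\<omega>. (u \<bullet> Y \<omega>) ^ n * (F (Y \<omega>) * (z \<bullet> Y \<omega>))) =
      n * (u \<bullet> (S *v z)) * expectation (\<lambda>\<omega>. (u \<bullet> Y \<omega>) ^ (n - 1) * F (Y \<omega>))
      + expectation (\<lambda>\<omega>. (u \<bullet> Y \<omega>) ^ n * F' (Y \<omega>)))"

text \<open>The quadratic stands for the variance of (u + e z) . Y, with b = u . S z. For even n
  both sides vanish: the moment on the left is odd, and on the right either n = 0 or n - 1 is
  odd.\<close>

lemma gaussian_moment_deriv:
  "((\<lambda>e. gaussian_moment (Suc n) (a + 2 * b * e + c * e\<^sup>2)) has_real_derivative
      Suc n * (n * b * gaussian_moment (n - 1) a)) (at 0)"
proof (cases "even n")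
  case True
  then show ?thesis by (cases n) (auto simp: gaussian_moment_def)
next
  case False
  then obtain k where k: "n = 2 * k + 1" by (auto elim: oddE)
  define C :: real where "C = fact (2 * k + 2) / (2 ^ (k + 1) * fact (k + 1))"
  have "((\<lambda>e. C * (a + 2 * b * e + c * e\<^sup>2) ^ Suc k)
    has_real_derivative C * (Suc k * a ^ k * (2 * b))) (at 0)"
    by (auto intro!: derivative_eq_intros simp del: power_Suc)
  moreover have "C * (Suc k * a ^ k * (2 * b)) = Suc n * (n * b * gaussian_moment (n - 1) a)"
  proof -
    have "C * Suc k * 2 = real (Suc n) * real n * (fact (2 * k) / (2 ^ k * fact k))"
      by (simp add: C_def k divide_simps)
    moreover have "C * (Suc k * a ^ k * (2 * b)) = (C * Suc k * 2) * (a ^ k * b)"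
      by (simp only: mult_ac)
    moreover have "gaussian_moment (n - 1) a = fact (2 * k) / (2 ^ k * fact k) * a ^ k"
      by (simp add: k gaussian_moment_def)
    ultimately show ?thesis by (simp only: mult_ac)
  qed
  moreover have "gaussian_moment (Suc n) x = C * x ^ Suc k" for x
    by (simp add: k gaussian_moment_def C_def)
  ultimately show ?thesis by (simp only:)
qed

lemma ibp_cong:
  assumes "ibp z F F'" "\<And>y. F y = G y" "\<And>y. F' y = G' y"
  shows "ibp z G G'"
proof -
  have "F = G" "F' = G'" using assms(2,3) by auto
  with assms(1) show ?thesis by simp
qed

text \<open>The derivative at e = 0 of the moment of order n + 1 of (u + e z) . Y is computed twice,
  from the known one-dimensional law and under the expectation.\<close>

lemma ibp_one: "ibp z (\<lambda>_. 1) (\<lambda>_. 0)"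
  unfolding ibp_def
proof (intro conjI allI poly_growth_intros)
  fix n u
  have q: "(u + e *\<^sub>R z) \<bullet> (S *v (u + e *\<^sub>R z)) = u \<bullet> (S *v u) + 2 * (u \<bullet> (S *v z)) * e + (z \<bullet> (S *v z)) * e\<^sup>2" for e
    using symmetric_matrix_inner[OF sym, of z u]
    by (simp add: matrix_vector_right_distrib matrix_vector_mult_scaleR inner_add_left inner_add_right
       power2_eq_square algebra_simps inner_commute)
  have "((\<lambda>e. expectation (\<lambda>\<omega>. ((u + e *\<^sub>R z) \<bullet> Y \<omega>) ^ Suc n)) has_real_derivative
      Suc n * (n * (u \<bullet> (S *v z)) * gaussian_moment (n - 1) (u \<bullet> (S *v u)))) (at 0)"
    unfolding expectation_linear_power(2) q by (rule gaussian_moment_deriv)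
  moreover have "((\<lambda>e. expectation (\<lambda>\<omega>. ((u + e *\<^sub>R z) \<bullet> Y \<omega>) ^ Suc n)) has_real_derivative
      Suc n * expectation (\<lambda>\<omega>. (u \<bullet> Y \<omega>) ^ n * (z \<bullet> Y \<omega>))) (at 0)"
    using deriv_expectation[OF poly_growth_const[of 1], of u z "Suc n"] by simp
  ultimately have "real (Suc n) * (n * (u \<bullet> (S *v z)) * gaussian_moment (n - 1) (u \<bullet> (S *v u)))
      = real (Suc n) * expectation (\<lambda>\<omega>. (u \<bullet> Y \<omega>) ^ n * (z \<bullet> Y \<omega>))"
    by (rule DERIV_unique)
  then have "n * (u \<bullet> (S *v z)) * gaussian_moment (n - 1) (u \<bullet> (S *v u))
      = expectation (\<lambda>\<omega>. (u \<bullet> Y \<omega>) ^ n * (z \<bullet> Y \<omega>))"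
    by (simp del: of_nat_Suc)
  then show "expectation (\<lambda>\<omega>. (u \<bullet> Y \<omega>) ^ n * (1 * (z \<bullet> Y \<omega>))) =
      n * (u \<bullet> (S *v z)) * expectation (\<lambda>\<omega>. (u \<bullet> Y \<omega>) ^ (n - 1) * 1) + expectation (\<lambda>\<omega>. (u \<bullet> Y \<omega>) ^ n * 0)"
    by (simp add: expectation_linear_power(2))
qed

text \<open>The hypothesis is used at exponent \<open>Suc n\<close>, so that differentiating along
  \<open>w\<close> lowers it to n and releases the factor \<open>w \<bullet> y\<close>; the common
  factor \<open>Suc n\<close> then cancels.\<close>

lemma ibp_mult_linear:
  assumes "ibp z F F'"
  shows "ibp z (\<lambda>y. (w \<bullet> y) * F y) (\<lambda>y. (w \<bullet> (S *v z)) * F y + (w \<bullet> y) * F' y)"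
proof -
  have F: "poly_growth F" and F': "poly_growth F'"
    and I: "\<And>n u. expectation (\<lambda>\<omega>. (u \<bullet> Y \<omega>) ^ n * (F (Y \<omega>) * (z \<bullet> Y \<omega>))) =
      n * (u \<bullet> (S *v z)) * expectation (\<lambda>\<omega>. (u \<bullet> Y \<omega>) ^ (n - 1) * F (Y \<omega>))
      + expectation (\<lambda>\<omega>. (u \<bullet> Y \<omega>) ^ n * F' (Y \<omega>))"
    using assms by (simp_all add: ibp_def)
  have "expectation (\<lambda>\<omega>. (u \<bullet> Y \<omega>) ^ n * ((w \<bullet> Y \<omega>) * F (Y \<omega>) * (z \<bullet> Y \<omega>))) =
      n * (u \<bullet> (S *v z)) * expectation (\<lambda>\<omega>. (u \<bullet> Y \<omega>) ^ (n - 1) * ((w \<bullet> Y \<omega>) * F (Y \<omega>)))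
      + expectation (\<lambda>\<omega>. (u \<bullet> Y \<omega>) ^ n * ((w \<bullet> (S *v z)) * F (Y \<omega>) + (w \<bullet> Y \<omega>) * F' (Y \<omega>)))" for n u
  proof -
    have Fz: "poly_growth (\<lambda>y. F y * (z \<bullet> y))" by (intro poly_growth_intros F)
    have A: "((\<lambda>e. (Suc n * ((u + e *\<^sub>R w) \<bullet> (S *v z))) * expectation (\<lambda>\<omega>. ((u + e *\<^sub>R w) \<bullet> Y \<omega>) ^ n * F (Y \<omega>))
        + expectation (\<lambda>\<omega>. ((u + e *\<^sub>R w) \<bullet> Y \<omega>) ^ Suc n * F' (Y \<omega>))) has_real_derivative
        (Suc n * (w \<bullet> (S *v z))) * expectation (\<lambda>\<omega>. ((u + 0 *\<^sub>R w) \<bullet> Y \<omega>) ^ n * F (Y \<omega>))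
        + (n * expectation (\<lambda>\<omega>. (u \<bullet> Y \<omega>) ^ (n - 1) * ((w \<bullet> Y \<omega>) * F (Y \<omega>)))) * (Suc n * ((u + 0 *\<^sub>R w) \<bullet> (S *v z)))
        + Suc n * expectation (\<lambda>\<omega>. (u \<bullet> Y \<omega>) ^ (Suc n - 1) * ((w \<bullet> Y \<omega>) * F' (Y \<omega>)))) (at 0)"
    proof (intro DERIV_add DERIV_mult deriv_expectation F F')
      show "((\<lambda>e. Suc n * ((u + e *\<^sub>R w) \<bullet> (S *v z))) has_real_derivative Suc n * (w \<bullet> (S *v z))) (at 0)"
        unfolding inner_add_left inner_scaleR_left by (auto intro!: derivative_eq_intros)
    qed
    have B: "((\<lambda>e. expectation (\<lambda>\<omega>. ((u + e *\<^sub>R w) \<bullet> Y \<omega>) ^ Suc n * (F (Y \<omega>) * (z \<bullet> Y \<omega>)))) has_real_derivative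
        Suc n * expectation (\<lambda>\<omega>. (u \<bullet> Y \<omega>) ^ (Suc n - 1) * ((w \<bullet> Y \<omega>) * (F (Y \<omega>) * (z \<bullet> Y \<omega>))))) (at 0)"
      by (rule deriv_expectation[OF Fz])
    have "real (Suc n) * expectation (\<lambda>\<omega>. (u \<bullet> Y \<omega>) ^ n * ((w \<bullet> Y \<omega>) * (F (Y \<omega>) * (z \<bullet> Y \<omega>)))) =
      real (Suc n) * ((w \<bullet> (S *v z)) * expectation (\<lambda>\<omega>. (u \<bullet> Y \<omega>) ^ n * F (Y \<omega>))
        + n * (u \<bullet> (S *v z)) * expectation (\<lambda>\<omega>. (u \<bullet> Y \<omega>) ^ (n - 1) * ((w \<bullet> Y \<omega>) * F (Y \<omega>)))
        + expectation (\<lambda>\<omega>. (u \<bullet> Y \<omega>) ^ n * ((w \<bullet> Y \<omega>) * F' (Y \<omega>))))"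
      using DERIV_unique[OF B[unfolded I diff_Suc_1] A[unfolded diff_Suc_1]] by (simp add: algebra_simps)
    then have 1: "expectation (\<lambda>\<omega>. (u \<bullet> Y \<omega>) ^ n * ((w \<bullet> Y \<omega>) * (F (Y \<omega>) * (z \<bullet> Y \<omega>)))) =
      (w \<bullet> (S *v z)) * expectation (\<lambda>\<omega>. (u \<bullet> Y \<omega>) ^ n * F (Y \<omega>))
        + n * (u \<bullet> (S *v z)) * expectation (\<lambda>\<omega>. (u \<bullet> Y \<omega>) ^ (n - 1) * ((w \<bullet> Y \<omega>) * F (Y \<omega>)))
        + expectation (\<lambda>\<omega>. (u \<bullet> Y \<omega>) ^ n * ((w \<bullet> Y \<omega>) * F' (Y \<omega>)))"
      unfolding mult_cancel_left by simp
    have int: "integrable M (\<lambda>\<omega>. (u \<bullet> Y \<omega>) ^ n * F (Y \<omega>))"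
      "integrable M (\<lambda>\<omega>. (u \<bullet> Y \<omega>) ^ n * ((w \<bullet> Y \<omega>) * F' (Y \<omega>)))"
      by (rule integrable_poly_growth, intro poly_growth_intros F F')+
    have "expectation (\<lambda>\<omega>. (u \<bullet> Y \<omega>) ^ n * ((w \<bullet> (S *v z)) * F (Y \<omega>) + (w \<bullet> Y \<omega>) * F' (Y \<omega>))) =
      expectation (\<lambda>\<omega>. (w \<bullet> (S *v z)) * ((u \<bullet> Y \<omega>) ^ n * F (Y \<omega>)) + (u \<bullet> Y \<omega>) ^ n * ((w \<bullet> Y \<omega>) * F' (Y \<omega>)))"
      by (rule arg_cong[where f = expectation]) (simp add: algebra_simps)
    also have "\<dots> = (w \<bullet> (S *v z)) * expectation (\<lambda>\<omega>. (u \<bullet> Y \<omega>) ^ n * F (Y \<omega>))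
        + expectation (\<lambda>\<omega>. (u \<bullet> Y \<omega>) ^ n * ((w \<bullet> Y \<omega>) * F' (Y \<omega>)))"
      using int by simp
    finally show ?thesis using 1 by (simp add: mult.assoc)
  qed
  moreover have "poly_growth (\<lambda>y. (w \<bullet> y) * F y)"
    "poly_growth (\<lambda>y. (w \<bullet> (S *v z)) * F y + (w \<bullet> y) * F' y)"
    by (intro poly_growth_intros F F')+
  ultimately show ?thesis unfolding ibp_def by blast
qed

lemma ibp_sum:
  assumes "\<And>i. i \<in> I \<Longrightarrow> ibp z (F i) (F' i)"
  shows "ibp z (\<lambda>y. \<Sum>i\<in>I. F i y) (\<lambda>y. \<Sum>i\<in>I. F' i y)"
proof -
  have F: "poly_growth (F i)" "poly_growth (F' i)" if "i \<in> I" for i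
    using assms[OF that] unfolding ibp_def by auto
  have int: "integrable M (\<lambda>\<omega>. (u \<bullet> Y \<omega>) ^ n * (F i (Y \<omega>) * (z \<bullet> Y \<omega>)))"
    "integrable M (\<lambda>\<omega>. (u \<bullet> Y \<omega>) ^ n * F i (Y \<omega>))" "integrable M (\<lambda>\<omega>. (u \<bullet> Y \<omega>) ^ n * F' i (Y \<omega>))"
    if "i \<in> I" for i u n
    by (rule integrable_poly_growth, intro poly_growth_intros F[OF that])+
  show ?thesis
    unfolding ibp_def
  proof (intro conjI allI poly_growth_sum F)
    fix n u
    show "expectation (\<lambda>\<omega>. (u \<bullet> Y \<omega>) ^ n * ((\<Sum>i\<in>I. F i (Y \<omega>)) * (z \<bullet> Y \<omega>))) =
      n * (u \<bullet> (S *v z)) * expectation (\<lambda>\<omega>. (u \<bullet> Y \<omega>) ^ (n - 1) * (\<Sum>i\<in>I. F i (Y \<omega>)))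
      + expectation (\<lambda>\<omega>. (u \<bullet> Y \<omega>) ^ n * (\<Sum>i\<in>I. F' i (Y \<omega>)))"
      unfolding sum_distrib_left sum_distrib_right
      using assms int
      by (simp add: Bochner_Integration.integral_sum ibp_def sum.distrib sum_distrib_left)
  qed
qed

text \<open>The squared norm is the sum of squared coordinates, each supplied by two multiplications
  with a linear form.\<close>

lemma ibp_mult_inner_self:
  assumes "ibp z F F'"
  shows "ibp z (\<lambda>y. (y \<bullet> y) * F y) (\<lambda>y. 2 * ((S *v z) \<bullet> y) * F y + (y \<bullet> y) * F' y)"
proof -
  have *: "x \<bullet> y = (\<Sum>i\<in>UNIV. (axis i 1 \<bullet> x) * (axis i 1 \<bullet> y))" for x y :: "real^'d"
    unfolding inner_axis' by (simp add: inner_vec_def)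
  have "ibp z (\<lambda>y. \<Sum>i\<in>UNIV. (axis i 1 \<bullet> y) * ((axis i 1 \<bullet> y) * F y))
    (\<lambda>y. \<Sum>i\<in>UNIV. (axis i 1 \<bullet> (S *v z)) * ((axis i 1 \<bullet> y) * F y)
      + (axis i 1 \<bullet> y) * ((axis i 1 \<bullet> (S *v z)) * F y + (axis i 1 \<bullet> y) * F' y))"
    by (intro ibp_sum ibp_mult_linear assms)
  also have "(\<lambda>y. \<Sum>i\<in>UNIV. (axis i 1 \<bullet> y) * ((axis i 1 \<bullet> y) * F y)) = (\<lambda>y. (y \<bullet> y) * F y)"
    by (subst *) (simp add: sum_distrib_right mult.assoc)
  also have "(\<lambda>y. \<Sum>i\<in>UNIV. (axis i 1 \<bullet> (S *v z)) * ((axis i 1 \<bullet> y) * F y)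
      + (axis i 1 \<bullet> y) * ((axis i 1 \<bullet> (S *v z)) * F y + (axis i 1 \<bullet> y) * F' y))
      = (\<lambda>y. 2 * ((S *v z) \<bullet> y) * F y + (y \<bullet> y) * F' y)"
  proof
    fix y
    have "(\<Sum>i\<in>UNIV. (axis i 1 \<bullet> (S *v z)) * ((axis i 1 \<bullet> y) * F y)
      + (axis i 1 \<bullet> y) * ((axis i 1 \<bullet> (S *v z)) * F y + (axis i 1 \<bullet> y) * F' y))
      = 2 * (\<Sum>i\<in>UNIV. (axis i 1 \<bullet> (S *v z)) * (axis i 1 \<bullet> y)) * F y
        + (\<Sum>i\<in>UNIV. (axis i 1 \<bullet> y) * (axis i 1 \<bullet> y)) * F' y"
      unfolding sum_distrib_left sum_distrib_right sum.distrib[symmetric]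
      by (intro sum.cong refl) (simp add: algebra_simps)
    then show "(\<Sum>i\<in>UNIV. (axis i 1 \<bullet> (S *v z)) * ((axis i 1 \<bullet> y) * F y)
      + (axis i 1 \<bullet> y) * ((axis i 1 \<bullet> (S *v z)) * F y + (axis i 1 \<bullet> y) * F' y))
      = 2 * ((S *v z) \<bullet> y) * F y + (y \<bullet> y) * F' y"
      by (simp only: *[symmetric])
  qed
  finally show ?thesis .
qed

lemma ibp_norm_power:
  "ibp z (\<lambda>y. (y \<bullet> y) ^ n * (x \<bullet> y))
    (\<lambda>y. 2 * real n * (y \<bullet> y) ^ (n - 1) * ((S *v z) \<bullet> y) * (x \<bullet> y) + (y \<bullet> y) ^ n * (x \<bullet> (S *v z)))"
proof (induction n)
  case 0
  show ?case using ibp_mult_linear[OF ibp_one, of z x] by simp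
next
  case (Suc n)
  have eq: "2 * ((S *v z) \<bullet> y) * ((y \<bullet> y) ^ n * (x \<bullet> y)) + (y \<bullet> y) *
      (2 * real n * (y \<bullet> y) ^ (n - 1) * ((S *v z) \<bullet> y) * (x \<bullet> y) + (y \<bullet> y) ^ n * (x \<bullet> (S *v z)))
    = 2 * real (Suc n) * (y \<bullet> y) ^ (Suc n - 1) * ((S *v z) \<bullet> y) * (x \<bullet> y) + (y \<bullet> y) ^ Suc n * (x \<bullet> (S *v z))" for y
    by (cases n) (simp_all add: algebra_simps)
  have eq': "(y \<bullet> y) * ((y \<bullet> y) ^ n * (x \<bullet> y)) = (y \<bullet> y) ^ Suc n * (x \<bullet> y)" for y
    by (simp add: mult.assoc)
  show ?case by (rule ibp_cong[OF ibp_mult_inner_self[OF Suc] eq' eq])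
qed

text \<open>Each step replaces z by S z and lowers the power of the norm, so the recursion becomes
  diagonal when z is an eigenvector of S.\<close>

lemma moment_recursion:
  "expectation (\<lambda>\<omega>. (Y \<omega> \<bullet> Y \<omega>) ^ n * (x \<bullet> Y \<omega>) * (z \<bullet> Y \<omega>)) =
    2 * real n * expectation (\<lambda>\<omega>. (Y \<omega> \<bullet> Y \<omega>) ^ (n - 1) * (x \<bullet> Y \<omega>) * ((S *v z) \<bullet> Y \<omega>))
    + (x \<bullet> (S *v z)) * expectation (\<lambda>\<omega>. (Y \<omega> \<bullet> Y \<omega>) ^ n)"
proof -
  have int: "integrable M (\<lambda>\<omega>. (Y \<omega> \<bullet> Y \<omega>) ^ k)" "integrable M (\<lambda>\<omega>. (Y \<omega> \<bullet> Y \<omega>) ^ k * (x \<bullet> Y \<omega>) * (w \<bullet> Y \<omega>))" for k w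
    by (rule integrable_poly_growth, intro poly_growth_intros)+
  have "expectation (\<lambda>\<omega>. (Y \<omega> \<bullet> Y \<omega>) ^ n * (x \<bullet> Y \<omega>) * (z \<bullet> Y \<omega>)) =
    expectation (\<lambda>\<omega>. 2 * real n * (Y \<omega> \<bullet> Y \<omega>) ^ (n - 1) * ((S *v z) \<bullet> Y \<omega>) * (x \<bullet> Y \<omega>) + (Y \<omega> \<bullet> Y \<omega>) ^ n * (x \<bullet> (S *v z)))"
    \<comment> \<open>The auxiliary power of \<open>u \<bullet> Y\<close> is taken with exponent 0:
      it becomes 1 and its derivative term vanishes.\<close>
    using ibp_norm_power[of z n x, unfolded ibp_def, THEN conjunct2, THEN conjunct2, rule_format, of _ 0] by simp
  also have "\<dots> = expectation (\<lambda>\<omega>. (2 * real n) * ((Y \<omega> \<bullet> Y \<omega>) ^ (n - 1) * (x \<bullet> Y \<omega>) * ((S *v z) \<bullet> Y \<omega>)) + (x \<bullet> (S *v z)) * (Y \<omega> \<bullet> Y \<omega>) ^ n)"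
    by (rule arg_cong[where f = expectation]) (simp add: mult_ac)
  also have "\<dots> = expectation (\<lambda>\<omega>. (2 * real n) * ((Y \<omega> \<bullet> Y \<omega>) ^ (n - 1) * (x \<bullet> Y \<omega>) * ((S *v z) \<bullet> Y \<omega>)))
      + expectation (\<lambda>\<omega>. (x \<bullet> (S *v z)) * (Y \<omega> \<bullet> Y \<omega>) ^ n)"
    by (intro Bochner_Integration.integral_add integrable_mult_right int)
  finally show ?thesis by simp
qed

end

section \<open>Matrix moment generating function of a Gaussian square\<close>

lemma symmetric_matrix_outer_self: "symmetric_matrix (outer_self y)"
  by (simp add: symmetric_matrix_def outer_self_def transpose_def vec_eq_iff mult.commute)

lemma outer_self_mult: "outer_self y *v z = (y \<bullet> z) *\<^sub>R y"
  by (simp add: outer_self_def matrix_vector_mult_def vec_eq_iff inner_vec_def sum_distrib_right sum_distrib_left mult_ac)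

lemma matpow_outer_self:
  "matpow (c *\<^sub>R outer_self y) (Suc n) *v z = (c ^ Suc n * (y \<bullet> y) ^ n * (y \<bullet> z)) *\<^sub>R y"
proof (induction n)
  case 0
  show ?case by (simp add: scaleR_matrix_vector_assoc[symmetric] outer_self_mult)
next
  case (Suc n)
  have "matpow (c *\<^sub>R outer_self y) (Suc (Suc n)) *v z = (c *\<^sub>R outer_self y) *v (matpow (c *\<^sub>R outer_self y) (Suc n) *v z)"
    by (simp only: matpow.simps matrix_vector_mul_assoc)
  also have "\<dots> = (c ^ Suc (Suc n) * (y \<bullet> y) ^ Suc n * (y \<bullet> z)) *\<^sub>R y"
    unfolding Suc scaleR_matrix_vector_assoc[symmetric] matrix_vector_mult_scaleR outer_self_mult by simp
  finally show ?case .
qed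

lemma mexp_bilinear_sums:
  assumes "symmetric_matrix A"
  shows "(\<lambda>n. x \<bullet> (matpow A n *v z) / fact n) sums (x \<bullet> (mexp A *v z))"
proof -
  have *: "x \<bullet> (B *v z) = (\<Sum>i\<in>UNIV. \<Sum>k\<in>UNIV. x $ i * z $ k * B $ i $ k)" for B
    by (simp add: inner_vec_def matrix_vector_mult_def sum_distrib_left mult_ac)
  have "(\<lambda>n. \<Sum>i\<in>UNIV. \<Sum>k\<in>UNIV. x $ i * z $ k * (matpow A n $ i $ k / fact n)) sums
     (\<Sum>i\<in>UNIV. \<Sum>k\<in>UNIV. x $ i * z $ k * mexp A $ i $ k)"
    by (intro sums_sum sums_mult mexp_sums assms)
  then show ?thesis unfolding * by (simp add: sum_divide_distrib)
qed

text \<open>The identity term is split off; every later power is a multiple of the outer product, so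
  the series has exactly the integrands of the moment recursion.\<close>

lemma mexp_outer_self_sums:
  "(\<lambda>n. c ^ Suc n / fact (Suc n) * ((y \<bullet> y) ^ n * (x \<bullet> y) * (z \<bullet> y))) sums
     (x \<bullet> (mexp (c *\<^sub>R outer_self y) *v z) - x \<bullet> z)"
proof -
  have "(\<lambda>n. x \<bullet> (matpow (c *\<^sub>R outer_self y) n *v z) / fact n) sums (x \<bullet> (mexp (c *\<^sub>R outer_self y) *v z))"
    by (intro mexp_bilinear_sums symmetric_matrix_scaleR symmetric_matrix_outer_self)
  then have "(\<lambda>n. x \<bullet> (matpow (c *\<^sub>R outer_self y) (Suc n) *v z) / fact (Suc n)) sums
      (x \<bullet> (mexp (c *\<^sub>R outer_self y) *v z) - x \<bullet> z)"
    by (subst sums_Suc_iff) simp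
  then show ?thesis
    unfolding matpow_outer_self by (simp add: inner_commute mult_ac)
qed

lemma spectral_norm_quadratic:
  "x \<bullet> (A *v x) \<le> spectral_norm A * (x \<bullet> x)"
proof -
  have "x \<bullet> (A *v x) \<le> norm x * norm (A *v x)" by (rule norm_cauchy_schwarz)
  also have "\<dots> \<le> norm x * (spectral_norm A * norm x)"
    unfolding spectral_norm_def
    by (intro mult_left_mono onorm matrix_vector_mul_bounded_linear norm_ge_zero)
  finally show ?thesis by (simp add: power2_norm_eq_inner[symmetric] power2_eq_square mult_ac)
qed

section \<open>Moments in an eigenbasis of the covariance matrix\<close>

locale centered_gaussian_eigenbasis = centered_gaussian M Y S
  for M :: "'a measure" and Y :: "'a \<Rightarrow> real^'d" and S :: "real^'d^'d" +
  fixes u :: "'d \<Rightarrow> real^'d" and a :: "'d \<Rightarrow> real"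
  assumes eigen: "eigenbasis S u a"
begin

lemma onb: "onb u" and S_u: "S *v u i = a i *\<^sub>R u i"
  using eigen by (auto simp: eigenbasis_def)

lemma a_nonneg: "0 \<le> a i"
proof -
  have "0 \<le> u i \<bullet> (S *v u i)" using psd by (simp add: pos_semidef_def)
  then show ?thesis by (simp add: S_u onb_inner[OF onb])
qed

lemma a_le: "a i \<le> spectral_norm S"
  using spectral_norm_quadratic[of "u i" S] by (simp add: S_u onb_inner[OF onb])

lemma trace_S: "trace S = sum a UNIV"
  by (rule eigenbasis_trace[OF eigen])

lemma trace_S_nonneg: "0 \<le> trace S"
  unfolding trace_S by (intro sum_nonneg a_nonneg)

lemma spectral_norm_nonneg: "0 \<le> spectral_norm S"
  using a_nonneg a_le order_trans by blast

definition norm_moment :: "nat \<Rightarrow> real" where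
  "norm_moment n = expectation (\<lambda>\<omega>. (Y \<omega> \<bullet> Y \<omega>) ^ n)"

definition cross_moment :: "nat \<Rightarrow> 'd \<Rightarrow> 'd \<Rightarrow> real" where
  "cross_moment n i j = expectation (\<lambda>\<omega>. (Y \<omega> \<bullet> Y \<omega>) ^ n * (u i \<bullet> Y \<omega>) * (u j \<bullet> Y \<omega>))"

lemma integrable_norm_moment: "integrable M (\<lambda>\<omega>. (Y \<omega> \<bullet> Y \<omega>) ^ n)"
  by (rule integrable_poly_growth, intro poly_growth_intros)

lemma integrable_cross_moment: "integrable M (\<lambda>\<omega>. (Y \<omega> \<bullet> Y \<omega>) ^ n * (x \<bullet> Y \<omega>) * (z \<bullet> Y \<omega>))"
  by (rule integrable_poly_growth, intro poly_growth_intros)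

lemma norm_moment_nonneg: "0 \<le> norm_moment n"
  unfolding norm_moment_def by (intro integral_nonneg_AE AE_I2) simp

lemma cross_moment_nonneg: "0 \<le> cross_moment n i i"
  unfolding cross_moment_def by (intro integral_nonneg_AE AE_I2) (simp add: mult.assoc)

lemma norm_moment_0: "norm_moment 0 = 1"
  by (simp add: norm_moment_def prob_space)

lemma cross_moment_rec:
  "cross_moment n i j = 2 * real n * (a j * cross_moment (n - 1) i j) + (if i = j then a j * norm_moment n else 0)"
  unfolding cross_moment_def norm_moment_def moment_recursion[of n "u i" "u j"] S_u
  by (simp add: onb_inner[OF onb] mult_ac)

text \<open>The recursion has no inhomogeneous term off the diagonal. Hence the mean of the matrix
  exponential is diagonal in the eigenbasis of \<open>S\<close>.\<close>

lemma cross_moment_offdiag: "i \<noteq> j \<Longrightarrow> cross_moment n i j = 0"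
proof (induction n)
  case 0
  then show ?case by (subst cross_moment_rec) simp
next
  case (Suc n)
  then show ?case by (subst cross_moment_rec) simp
qed

lemma norm_moment_Suc: "norm_moment (Suc n) = (\<Sum>i\<in>UNIV. cross_moment n i i)"
proof -
  have "(Y \<omega> \<bullet> Y \<omega>) ^ Suc n = (\<Sum>i\<in>UNIV. (Y \<omega> \<bullet> Y \<omega>) ^ n * (u i \<bullet> Y \<omega>) * (u i \<bullet> Y \<omega>))" for \<omega>
    unfolding power_Suc2 mult.assoc sum_distrib_left[symmetric] onb_parseval[OF onb, of "Y \<omega>" "Y \<omega>", symmetric] ..
  then show ?thesis
    unfolding norm_moment_def cross_moment_def by (simp only: Bochner_Integration.integral_sum[OF integrable_cross_moment])
qed

text \<open>Summing the diagonal recursion and bounding each eigenvalue by the spectral norm, the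
  remaining cross moments add up to the moment of order n again.\<close>

lemma norm_moment_Suc_le: "norm_moment (Suc n) \<le> (trace S + 2 * real n * spectral_norm S) * norm_moment n"
proof -
  have "norm_moment (Suc n) = 2 * real n * (\<Sum>i\<in>UNIV. a i * cross_moment (n - 1) i i) + trace S * norm_moment n"
    unfolding norm_moment_Suc trace_S sum_distrib_left sum_distrib_right sum.distrib[symmetric]
    by (intro sum.cong refl, subst cross_moment_rec) simp
  moreover have "2 * real n * (\<Sum>i\<in>UNIV. a i * cross_moment (n - 1) i i) \<le> 2 * real n * (spectral_norm S * norm_moment n)"
  proof (cases n)
    case (Suc k)
    have "(\<Sum>i\<in>UNIV. a i * cross_moment k i i) \<le> spectral_norm S * norm_moment (Suc k)"
      unfolding norm_moment_Suc sum_distrib_left by (intro sum_mono mult_right_mono a_le cross_moment_nonneg)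
    then show ?thesis using Suc by (simp del: of_nat_Suc)
  qed simp
  ultimately show ?thesis by (simp add: algebra_simps)
qed

lemma norm_moment_1: "norm_moment 1 = trace S"
proof -
  have "cross_moment 0 i i = a i" for i by (subst cross_moment_rec) (simp add: norm_moment_0)
  then show ?thesis using norm_moment_Suc[of 0] by (simp add: trace_S)
qed

context
  fixes R :: real
  assumes R: "trace S + 4 * spectral_norm S \<le> R"
begin

lemma R_nonneg: "0 \<le> R"
  using R trace_S_nonneg spectral_norm_nonneg by linarith

lemma norm_moment_factor_le: "trace S + 2 * real n * spectral_norm S \<le> real (Suc n) * R"
proof -
  have "real n * (2 * spectral_norm S) \<le> real n * R"
    using R trace_S_nonneg spectral_norm_nonneg by (intro mult_left_mono) auto
  then show ?thesis using R trace_S_nonneg spectral_norm_nonneg by (simp add: algebra_simps)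
qed

lemma norm_moment_le: "norm_moment n \<le> fact n * R ^ n"
proof (induction n)
  case (Suc n)
  have "norm_moment (Suc n) \<le> (real (Suc n) * R) * (fact n * R ^ n)"
    using R_nonneg norm_moment_nonneg
    by (intro order_trans[OF norm_moment_Suc_le] mult_mono norm_moment_factor_le Suc.IH) auto
  then show ?case by (simp add: mult_ac)
qed (simp add: norm_moment_0)

text \<open>Sharper than n! R^n in that one factor \<open>R\<close> is kept as
  \<open>trace S\<close>, the form in which it enters the variance term tr(S) S.\<close>

lemma norm_moment_le': "norm_moment (Suc (Suc n)) \<le> trace S * (fact (Suc (Suc n)) / 2 * R ^ Suc n)"
proof (induction n)
  case 0
  have "norm_moment (Suc 1) \<le> R * trace S"
    using norm_moment_Suc_le[of 1] R trace_S_nonneg spectral_norm_nonneg mult_right_mono[of "trace S + 2 * spectral_norm S" R "trace S"]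
    by (simp add: norm_moment_1[simplified])
  then show ?case by (simp add: mult_ac numeral_2_eq_2)
next
  case (Suc n)
  have "norm_moment (Suc (Suc (Suc n))) \<le> (real (Suc (Suc (Suc n))) * R) * (trace S * (fact (Suc (Suc n)) / 2 * R ^ Suc n))"
    using R_nonneg norm_moment_nonneg
    by (intro order_trans[OF norm_moment_Suc_le] mult_mono norm_moment_factor_le Suc.IH) auto
  also have "\<dots> = trace S * (fact (Suc (Suc (Suc n))) / 2 * R ^ Suc (Suc n))"
    by (simp only: fact_Suc[of "Suc (Suc n)"] power_Suc[of R "Suc n"] of_nat_mult times_divide_eq_left times_divide_eq_right mult_ac)
  finally show ?case .
qed

text \<open>Equality holds at n = 0. In the induction one eigenvalue is absorbed into the spectral
  norm, so the variance factor is carried along unchanged and only powers of \<open>R\<close>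
  accumulate.\<close>

lemma cross_moment_le: "cross_moment (Suc n) i i \<le> fact (Suc (Suc n)) / 2 * R ^ n * (trace S * a i + 2 * (a i)\<^sup>2)"
proof (induction n)
  case 0
  have "cross_moment 0 i i = a i" by (subst cross_moment_rec) (simp add: norm_moment_0)
  then show ?case by (subst cross_moment_rec) (simp add: norm_moment_1[simplified] power2_eq_square mult_ac numeral_2_eq_2)
next
  case (Suc n)
  let ?v = "trace S * a i + 2 * (a i)\<^sup>2" and ?c = "fact (Suc (Suc n)) / 2 * R ^ n"
  have v: "0 \<le> ?v" "trace S * a i \<le> ?v" using trace_S_nonneg a_nonneg[of i] by auto
  have c: "0 \<le> ?c" using R_nonneg by simp
  have "cross_moment (Suc (Suc n)) i i = 2 * real (Suc (Suc n)) * (a i * cross_moment (Suc n) i i) + a i * norm_moment (Suc (Suc n))"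
    by (subst cross_moment_rec) simp
  also have "\<dots> \<le> 2 * real (Suc (Suc n)) * (spectral_norm S * (?c * ?v)) + a i * (trace S * (?c * R))"
  proof (intro add_mono mult_left_mono mult_mono Suc.IH)
    show "norm_moment (Suc (Suc n)) \<le> trace S * (?c * R)" using norm_moment_le'[of n] by (simp add: mult_ac)
  qed (use a_le a_nonneg spectral_norm_nonneg cross_moment_nonneg in auto)
  also have "a i * (trace S * (?c * R)) = (trace S * a i) * (?c * R)" by (simp only: mult_ac)
  also have "\<dots> \<le> ?v * (?c * R)" using v c R_nonneg by (intro mult_right_mono) auto
  also have "2 * real (Suc (Suc n)) * (spectral_norm S * (?c * ?v)) + ?v * (?c * R)
      = (2 * real (Suc (Suc n)) * spectral_norm S + R) * (?c * ?v)"
  proof -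
    have "2 * N * (s * (c * v)) + v * (c * R) = (2 * N * s + R) * (c * v)" for N s c v R :: real
      by (simp add: algebra_simps)
    then show ?thesis .
  qed
  \<comment> \<open>Twice the spectral norm is at most \<open>R\<close>: n + 2 such terms and the
    single \<open>R\<close> from the norm moment give n + 3, the next factor of the
    factorial.\<close>
  also have "\<dots> \<le> (real (Suc (Suc (Suc n))) * R) * (?c * ?v)"
  proof (intro mult_right_mono)
    have "real (Suc (Suc n)) * (2 * spectral_norm S) \<le> real (Suc (Suc n)) * R"
      using R trace_S_nonneg spectral_norm_nonneg by (intro mult_left_mono) auto
    then show "2 * real (Suc (Suc n)) * spectral_norm S + R \<le> real (Suc (Suc (Suc n))) * R"
      by (simp add: algebra_simps)
  qed (use v c in auto)
  also have "\<dots> = fact (Suc (Suc (Suc n))) / 2 * R ^ Suc n * ?v"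
    by (simp only: fact_Suc[of "Suc (Suc n)"] power_Suc[of R n] of_nat_mult times_divide_eq_left times_divide_eq_right mult_ac)
  finally show ?case by simp
qed

section \<open>The mean of the matrix exponential as a moment series\<close>

context
  fixes \<theta> :: real
  assumes \<theta>: "0 \<le> \<theta>" "\<theta> * R < 1"
begin

definition mgf_term :: "nat \<Rightarrow> 'd \<Rightarrow> 'd \<Rightarrow> 'a \<Rightarrow> real" where
  "mgf_term n i j \<omega> = \<theta> ^ Suc n / fact (Suc n) * ((Y \<omega> \<bullet> Y \<omega>) ^ n * (u i \<bullet> Y \<omega>) * (u j \<bullet> Y \<omega>))"

lemma mgf_term_sums:
  "(\<lambda>n. mgf_term n i j \<omega>) sums (u i \<bullet> (mexp (\<theta> *\<^sub>R outer_self (Y \<omega>)) *v u j) - u i \<bullet> u j)"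
  unfolding mgf_term_def by (rule mexp_outer_self_sums)

lemma abs_mgf_term_le: "\<bar>mgf_term n i j \<omega>\<bar> \<le> \<theta> ^ Suc n / fact (Suc n) * (Y \<omega> \<bullet> Y \<omega>) ^ Suc n"
proof -
  have "norm (u k) = 1" for k by (simp add: norm_eq_1 onb_inner[OF onb])
  then have le: "\<bar>u k \<bullet> Y \<omega>\<bar> \<le> norm (Y \<omega>)" for k
    using Cauchy_Schwarz_ineq2[of "u k" "Y \<omega>"] by simp
  have "\<bar>(u i \<bullet> Y \<omega>) * (u j \<bullet> Y \<omega>)\<bar> \<le> norm (Y \<omega>) * norm (Y \<omega>)"
    unfolding abs_mult by (intro mult_mono le) auto
  then have "(Y \<omega> \<bullet> Y \<omega>) ^ n * \<bar>(u i \<bullet> Y \<omega>) * (u j \<bullet> Y \<omega>)\<bar> \<le> (Y \<omega> \<bullet> Y \<omega>) ^ n * (Y \<omega> \<bullet> Y \<omega>)"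
    by (intro mult_left_mono) (auto simp: power2_norm_eq_inner[symmetric] power2_eq_square)
  then have "\<theta> ^ Suc n / fact (Suc n) * ((Y \<omega> \<bullet> Y \<omega>) ^ n * \<bar>(u i \<bullet> Y \<omega>) * (u j \<bullet> Y \<omega>)\<bar>)
      \<le> \<theta> ^ Suc n / fact (Suc n) * ((Y \<omega> \<bullet> Y \<omega>) ^ n * (Y \<omega> \<bullet> Y \<omega>))"
    by (rule mult_left_mono) (use \<theta> in simp)
  moreover have "\<bar>mgf_term n i j \<omega>\<bar> = \<theta> ^ Suc n / fact (Suc n) * ((Y \<omega> \<bullet> Y \<omega>) ^ n * \<bar>(u i \<bullet> Y \<omega>) * (u j \<bullet> Y \<omega>)\<bar>)"
    using \<theta> unfolding mgf_term_def by (simp add: abs_mult mult.assoc)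
  ultimately show ?thesis by (simp only: power_Suc2)
qed

lemma integrable_mgf_term: "integrable M (mgf_term n i j)"
  unfolding mgf_term_def[abs_def] by (intro integrable_mult_right integrable_cross_moment)

lemma integral_mgf_term: "expectation (mgf_term n i j) = \<theta> ^ Suc n / fact (Suc n) * cross_moment n i j"
  unfolding mgf_term_def[abs_def] cross_moment_def by (rule integral_mult_right_zero)

text \<open>The factorial in the moment bound cancels that of the exponential series and leaves a
  geometric series of ratio \<open>\<theta> * R\<close>; this is the source of the restriction on
  \<open>\<theta>\<close>.\<close>

lemma summable_integral_mgf_term: "summable (\<lambda>n. \<integral>\<omega>. norm (mgf_term n i j \<omega>) \<partial>M)"
proof (rule summable_comparison_test)
  show "summable (\<lambda>n. (\<theta> * R) ^ Suc n)"
    using \<theta> R_nonneg by (intro summable_Suc_iff[THEN iffD2] summable_geometric) simp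
  have "(\<integral>\<omega>. norm (mgf_term n i j \<omega>) \<partial>M) \<le> (\<theta> * R) ^ Suc n" for n
  proof -
    have "(\<integral>\<omega>. norm (mgf_term n i j \<omega>) \<partial>M) \<le> (\<integral>\<omega>. \<theta> ^ Suc n / fact (Suc n) * (Y \<omega> \<bullet> Y \<omega>) ^ Suc n \<partial>M)"
    proof (rule integral_mono)
      show "integrable M (\<lambda>\<omega>. norm (mgf_term n i j \<omega>))" by (intro integrable_norm integrable_mgf_term)
      show "integrable M (\<lambda>\<omega>. \<theta> ^ Suc n / fact (Suc n) * (Y \<omega> \<bullet> Y \<omega>) ^ Suc n)"
        by (intro integrable_mult_right integrable_norm_moment)
      show "norm (mgf_term n i j \<omega>) \<le> \<theta> ^ Suc n / fact (Suc n) * (Y \<omega> \<bullet> Y \<omega>) ^ Suc n" for \<omega>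
        unfolding real_norm_def by (rule abs_mgf_term_le)
    qed
    also have "\<dots> = \<theta> ^ Suc n / fact (Suc n) * norm_moment (Suc n)"
      unfolding norm_moment_def by (rule integral_mult_right_zero)
    also have "\<dots> \<le> \<theta> ^ Suc n / fact (Suc n) * (fact (Suc n) * R ^ Suc n)"
      using \<theta> by (intro mult_left_mono norm_moment_le) auto
    also have "\<dots> = (\<theta> * R) ^ Suc n" unfolding power_mult_distrib by simp
    finally show ?thesis .
  qed
  then show "\<exists>N. \<forall>n\<ge>N. norm (\<integral>\<omega>. norm (mgf_term n i j \<omega>) \<partial>M) \<le> (\<theta> * R) ^ Suc n" by simp
qed

text \<open>Sum and expectation are exchanged: pointwise absolute convergence comes from the
  exponential series in |Y|^2, summability of the integrals from the geometric bound.\<close>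

lemma mgf_entry:
  shows "integrable M (\<lambda>\<omega>. u i \<bullet> (mexp (\<theta> *\<^sub>R outer_self (Y \<omega>)) *v u j))"
    and "expectation (\<lambda>\<omega>. u i \<bullet> (mexp (\<theta> *\<^sub>R outer_self (Y \<omega>)) *v u j)) =
      u i \<bullet> u j + (\<Sum>n. \<theta> ^ Suc n / fact (Suc n) * cross_moment n i j)"
    and "summable (\<lambda>n. \<theta> ^ Suc n / fact (Suc n) * cross_moment n i j)"
proof -
  have *: "u i \<bullet> (mexp (\<theta> *\<^sub>R outer_self (Y \<omega>)) *v u j) = u i \<bullet> u j + (\<Sum>n. mgf_term n i j \<omega>)" for \<omega>
    using sums_unique[OF mgf_term_sums[of i j \<omega>]] by simp
  have "summable (\<lambda>n. norm (mgf_term n i j \<omega>))" for \<omega>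
  proof (rule summable_comparison_test)
    show "\<exists>N. \<forall>n\<ge>N. norm (norm (mgf_term n i j \<omega>)) \<le> (\<theta> * (Y \<omega> \<bullet> Y \<omega>)) ^ Suc n / fact (Suc n)"
      using abs_mgf_term_le[of _ i j \<omega>] by (simp add: power_mult_distrib del: power_Suc fact_Suc)
    show "summable (\<lambda>n. (\<theta> * (Y \<omega> \<bullet> Y \<omega>)) ^ Suc n / fact (Suc n))"
      using summable_exp[of "\<theta> * (Y \<omega> \<bullet> Y \<omega>)"]
      by (subst summable_Suc_iff[of "\<lambda>n. (\<theta> * (Y \<omega> \<bullet> Y \<omega>)) ^ n / fact n"]) (simp add: divide_inverse mult.commute)
  qed
  then have AE: "AE \<omega> in M. summable (\<lambda>n. norm (mgf_term n i j \<omega>))" by simp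
  note suminf = integrable_mgf_term AE summable_integral_mgf_term
  show "integrable M (\<lambda>\<omega>. u i \<bullet> (mexp (\<theta> *\<^sub>R outer_self (Y \<omega>)) *v u j))"
    unfolding * by (intro Bochner_Integration.integrable_add integrable_suminf[OF suminf]) simp
  have "expectation (\<lambda>\<omega>. u i \<bullet> u j + (\<Sum>n. mgf_term n i j \<omega>)) = expectation (\<lambda>\<omega>. u i \<bullet> u j) + expectation (\<lambda>\<omega>. \<Sum>n. mgf_term n i j \<omega>)"
    by (intro Bochner_Integration.integral_add integrable_suminf[OF suminf]) simp
  then show "expectation (\<lambda>\<omega>. u i \<bullet> (mexp (\<theta> *\<^sub>R outer_self (Y \<omega>)) *v u j)) =
      u i \<bullet> u j + (\<Sum>n. \<theta> ^ Suc n / fact (Suc n) * cross_moment n i j)"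
    unfolding * integral_suminf[OF suminf] integral_mgf_term by (simp add: prob_space)
  show "summable (\<lambda>n. \<theta> ^ Suc n / fact (Suc n) * cross_moment n i j)"
    unfolding integral_mgf_term[symmetric] using summable_integral[OF suminf] .
qed

lemma measurable_mexp_outer_self [measurable]:
  "(\<lambda>\<omega>. mexp (\<theta> *\<^sub>R outer_self (Y \<omega>))) \<in> borel_measurable M"
proof (rule borel_measurable_mexp, rule borel_measurable_matrixI)
  show "(\<lambda>\<omega>. (\<theta> *\<^sub>R outer_self (Y \<omega>)) $ i $ k) \<in> borel_measurable M" for i k
    unfolding outer_self_def vector_scaleR_component vec_lambda_beta by measurable
qed

lemma integrable_mexp_outer_self: "integrable M (\<lambda>\<omega>. mexp (\<theta> *\<^sub>R outer_self (Y \<omega>)))"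
proof (rule Bochner_Integration.integrable_bound)
  show "integrable M (\<lambda>\<omega>. \<Sum>i\<in>UNIV. u i \<bullet> (mexp (\<theta> *\<^sub>R outer_self (Y \<omega>)) *v u i))"
    by (intro Bochner_Integration.integrable_sum mgf_entry(1))
  show "AE \<omega> in M. norm (mexp (\<theta> *\<^sub>R outer_self (Y \<omega>))) \<le>
      norm (\<Sum>i\<in>UNIV. u i \<bullet> (mexp (\<theta> *\<^sub>R outer_self (Y \<omega>)) *v u i))"
    unfolding trace_onb[OF onb, symmetric] real_norm_def
    by (intro AE_I2 order_trans[OF norm_mexp_le_trace abs_ge_self] symmetric_matrix_scaleR symmetric_matrix_outer_self)
qed measurable

text \<open>The first term is kept exactly, since it has to cancel against the centring. From the
  second term on, (n+2)!/2 cancels the factorial up to the factor 1/2 and the tail is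
  geometric.\<close>

lemma mgf_diag_le:
  "(\<Sum>n. \<theta> ^ Suc n / fact (Suc n) * cross_moment n i i) \<le>
    \<theta> * a i + \<theta>\<^sup>2 / (2 * (1 - \<theta> * R)) * (trace S * a i + 2 * (a i)\<^sup>2)"
proof -
  let ?f = "\<lambda>n. \<theta> ^ Suc n / fact (Suc n) * cross_moment n i i"
  let ?v = "trace S * a i + 2 * (a i)\<^sup>2"
  have r: "norm (\<theta> * R) < 1" using \<theta> R_nonneg by simp
  have sm: "summable (\<lambda>n. ?f (Suc n))"
    by (rule summable_Suc_iff[THEN iffD2, OF mgf_entry(3)])
  have "?f (Suc n) \<le> \<theta>\<^sup>2 / 2 * ?v * (\<theta> * R) ^ n" for n
  proof -
    have "?f (Suc n) \<le> \<theta> ^ Suc (Suc n) / fact (Suc (Suc n)) * (fact (Suc (Suc n)) / 2 * R ^ n * ?v)"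
      using \<theta> by (intro mult_left_mono cross_moment_le) auto
    also have "\<dots> = \<theta>\<^sup>2 / 2 * ?v * (\<theta> * R) ^ n"
      by (simp add: power_mult_distrib power2_eq_square del: fact_Suc)
    finally show ?thesis .
  qed
  then have "(\<Sum>n. ?f (Suc n)) \<le> (\<Sum>n. \<theta>\<^sup>2 / 2 * ?v * (\<theta> * R) ^ n)"
    by (intro suminf_le sm summable_mult summable_geometric r)
  also have "\<dots> = \<theta>\<^sup>2 / 2 * ?v * (1 / (1 - \<theta> * R))"
    unfolding suminf_mult[OF summable_geometric[OF r]] suminf_geometric[OF r] ..
  also have "\<dots> = \<theta>\<^sup>2 / (2 * (1 - \<theta> * R)) * ?v" by simp
  finally have "(\<Sum>n. ?f (Suc n)) \<le> \<theta>\<^sup>2 / (2 * (1 - \<theta> * R)) * ?v" .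
  moreover have "(\<Sum>n. ?f (Suc n)) = (\<Sum>n. ?f n) - ?f 0"
    by (rule suminf_split_head[OF mgf_entry(3)])
  moreover have "cross_moment 0 i i = a i" by (subst cross_moment_rec) (simp add: norm_moment_0)
  ultimately show ?thesis by simp
qed

text \<open>The mean exponential shares its eigenbasis with \<open>S\<close>, so the matrix
  inequality reduces to eigenvalues, where it is ln b <= b - 1. As b >= 1, the logarithm
  exists.\<close>

lemma log_mgf_outer_self:
  obtains L where "symmetric_matrix L" "mexp L = expectation (\<lambda>\<omega>. mexp (\<theta> *\<^sub>R outer_self (Y \<omega>)))"
    "\<And>x. x \<bullet> (L *v x) \<le>
      x \<bullet> ((\<theta> *\<^sub>R S + (\<theta>\<^sup>2 / (2 * (1 - \<theta> * R))) *\<^sub>R (trace S *\<^sub>R S + 2 *\<^sub>R (S ** S))) *v x)"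
proof -
  define B where "B = expectation (\<lambda>\<omega>. mexp (\<theta> *\<^sub>R outer_self (Y \<omega>)))"
  define b where "b = (\<lambda>i. 1 + (\<Sum>n. \<theta> ^ Suc n / fact (Suc n) * cross_moment n i i))"
  let ?f = "\<theta>\<^sup>2 / (2 * (1 - \<theta> * R))"
  let ?w = "\<lambda>i. \<theta> * a i + ?f * (trace S * a i + 2 * (a i)\<^sup>2)"
  have entry: "u i \<bullet> (B *v u j) = (if i = j then b j else 0)" for i j
    unfolding B_def integral_bilinear(1)[OF integrable_mexp_outer_self] mgf_entry(2)
    by (simp add: onb_inner[OF onb] b_def cross_moment_offdiag)
  have "B *v u j = b j *\<^sub>R u j" for j
    by (subst onb_expand[OF onb, of "B *v u j"]) (simp add: entry if_distrib if_distribR cong: if_cong)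
  then have B: "eigenbasis B u b" by (simp add: eigenbasis_def onb)
  have b: "1 \<le> b i" for i
  proof -
    have "0 \<le> (\<Sum>n. \<theta> ^ Suc n / fact (Suc n) * cross_moment n i i)"
      by (rule suminf_nonneg[OF mgf_entry(3)], rule mult_nonneg_nonneg[OF _ cross_moment_nonneg]) (use \<theta> in simp)
    then show ?thesis by (simp add: b_def)
  qed
  obtain L where L: "eigenbasis L u (\<lambda>i. ln (b i))" using eigenbasis_exists[OF onb] .
  have "exp (ln (b i)) = b i" for i using b[of i] by simp
  then have "(\<lambda>i. exp (ln (b i))) = b" by auto
  then have "mexp L = B" using B by (intro mexp_eqI[OF L]) (simp only:)
  moreover have "x \<bullet> (L *v x) \<le> x \<bullet> ((\<theta> *\<^sub>R S + ?f *\<^sub>R (trace S *\<^sub>R S + 2 *\<^sub>R (S ** S))) *v x)" for x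
  proof -
    have "eigenbasis (\<theta> *\<^sub>R S + ?f *\<^sub>R (trace S *\<^sub>R S + 2 *\<^sub>R (S ** S))) u ?w"
      unfolding eigenbasis_def matrix_vector_mult_add_rdistrib scaleR_matrix_vector_assoc[symmetric]
        matrix_vector_mul_assoc[symmetric] S_u matrix_vector_mult_scaleR
        scaleR_add_right scaleR_scaleR scaleR_left_distrib[symmetric]
      by (intro conjI allI onb arg_cong[where f = "\<lambda>c. c *\<^sub>R u _"]) (simp only: power2_eq_square distrib_left mult_ac)
    moreover have "ln (b i) \<le> ?w i" for i
    proof -
      have "ln (b i) \<le> b i - 1" using b[of i] by (intro ln_le_minus_one) simp
      also have "\<dots> \<le> ?w i" using mgf_diag_le[of i] by (simp add: b_def)
      finally show ?thesis .
    qed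
    ultimately show ?thesis
      using eigenbasis_quadratic[OF L] by (simp add: eigenbasis_quadratic sum_mono mult_right_mono)
  qed
  ultimately show thesis using that eigenbasis_symmetric[OF L] unfolding B_def by blast
qed

end

end

end

section \<open>Subadditivity of the trace moment generating function\<close>

lemma symmetric_matrix_sum:
  "(\<And>i. i \<in> I \<Longrightarrow> symmetric_matrix (f i)) \<Longrightarrow> symmetric_matrix (sum f I)"
  by (induction I rule: infinite_finite_induct) (auto intro: symmetric_matrix_add simp: symmetric_matrix_mat[of 0, simplified])

lemma sum_matrix_vector_mult: "sum f I *v x = (\<Sum>i\<in>I. f i *v x)"
  by (induction I rule: infinite_finite_induct) (auto simp: matrix_vector_mult_add_rdistrib)

section \<open>Scaling, norm bound and measurability of the largest eigenvalue\<close>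

lemma lambda_max_scaleR:
  assumes "symmetric_matrix A" "0 \<le> c"
  shows "lambda_max (c *\<^sub>R A) = c * lambda_max A"
proof (rule antisym)
  obtain x where x: "norm x = 1" "x \<bullet> ((c *\<^sub>R A) *v x) = lambda_max (c *\<^sub>R A)"
    using lambda_max_attained[OF symmetric_matrix_scaleR[OF assms(1)]] .
  have "lambda_max (c *\<^sub>R A) = c * (x \<bullet> (A *v x))"
    unfolding x(2)[symmetric] scaleR_matrix_vector_assoc[symmetric] by simp
  also have "\<dots> \<le> c * (lambda_max A * (x \<bullet> x))"
    by (intro mult_left_mono quadratic_le_lambda_max assms)
  finally show "lambda_max (c *\<^sub>R A) \<le> c * lambda_max A"
    using x(1) by (simp add: norm_eq_1)
next
  obtain x where x: "norm x = 1" "x \<bullet> (A *v x) = lambda_max A"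
    using lambda_max_attained[OF assms(1)] .
  have "c * lambda_max A = x \<bullet> ((c *\<^sub>R A) *v x)"
    unfolding x(2)[symmetric] scaleR_matrix_vector_assoc[symmetric] by simp
  also have "\<dots> \<le> lambda_max (c *\<^sub>R A) * (x \<bullet> x)"
    by (intro quadratic_le_lambda_max symmetric_matrix_scaleR assms)
  finally show "c * lambda_max A \<le> lambda_max (c *\<^sub>R A)"
    using x(1) by (simp add: norm_eq_1)
qed

lemma abs_lambda_max_le_norm:
  assumes "symmetric_matrix A"
  shows "\<bar>lambda_max A\<bar> \<le> norm A"
proof -
  obtain x where x: "norm x = 1" "x \<bullet> (A *v x) = lambda_max A"
    using lambda_max_attained[OF assms] .
  let ?B = "\<chi> i k. x $ i * x $ k"
  have "?B \<bullet> ?B = (x \<bullet> x) * (x \<bullet> x)"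
    by (simp add: inner_vec_def sum_product mult_ac)
  then have "norm ?B = 1" using x(1) by (simp add: norm_eq_1)
  then show ?thesis
    using Cauchy_Schwarz_ineq2[of A ?B] x(2) by (simp add: bilinear_eq_inner)
qed

text \<open>Exhibits \<open>lambda_max\<close> as a pointwise limit of functions that are visibly measurable.\<close>

lemma lambda_max_limit:
  fixes A :: "real^'d^'d"
  assumes "symmetric_matrix A"
  shows "(\<lambda>n. ln (trace (mexp (real n *\<^sub>R A))) / real n) \<longlonglongrightarrow> lambda_max A"
proof (rule tendsto_sandwich)
  have sym: "symmetric_matrix (real n *\<^sub>R A)" for n by (intro symmetric_matrix_scaleR assms)
  note lam = lambda_max_scaleR[OF assms, of "real n" for n, simplified]
  have lo: "exp (real n * lambda_max A) \<le> trace (mexp (real n *\<^sub>R A))" for n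
    using exp_lambda_max_le_trace[OF sym, of n] by (simp add: lam)
  have hi: "trace (mexp (real n *\<^sub>R A)) \<le> real CARD('d) * exp (real n * lambda_max A)" for n
    using trace_mexp_le_lambda_max[OF sym, of n] by (simp add: lam)
  have pos: "0 < trace (mexp (real n *\<^sub>R A))" for n
    using lo[of n] exp_gt_zero[of "real n * lambda_max A"] by linarith
  have lo': "real n * lambda_max A \<le> ln (trace (mexp (real n *\<^sub>R A)))" for n
    using lo[of n] pos[of n] by (simp add: ln_ge_iff)
  have hi': "ln (trace (mexp (real n *\<^sub>R A))) \<le> ln (real CARD('d)) + real n * lambda_max A" for n
  proof -
    have "ln (trace (mexp (real n *\<^sub>R A))) \<le> ln (real CARD('d) * exp (real n * lambda_max A))"
      using hi[of n] pos[of n] by (intro ln_mono) auto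
    then show ?thesis by (simp add: ln_mult)
  qed
  show "\<forall>\<^sub>F n in sequentially. lambda_max A \<le> ln (trace (mexp (real n *\<^sub>R A))) / real n"
    using eventually_gt_at_top[of 0] by eventually_elim (use lo' in \<open>simp add: field_simps\<close>)
  show "\<forall>\<^sub>F n in sequentially. ln (trace (mexp (real n *\<^sub>R A))) / real n \<le> ln (real CARD('d)) / real n + lambda_max A"
    using eventually_gt_at_top[of 0] by eventually_elim (use hi' in \<open>simp add: field_simps\<close>)
  show "(\<lambda>n. ln (real CARD('d)) / real n + lambda_max A) \<longlonglongrightarrow> lambda_max A"
    using tendsto_add[OF lim_const_over_n[of "ln (real CARD('d))"] tendsto_const[of "lambda_max A"]] by simp
qed simp

lemma borel_measurable_trace [measurable (raw)]:
  fixes X :: "'a \<Rightarrow> real^'d^'d"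
  assumes [measurable]: "X \<in> borel_measurable M"
  shows "(\<lambda>\<omega>. trace (X \<omega>)) \<in> borel_measurable M"
  unfolding trace_def by measurable

lemma borel_measurable_lambda_max:
  fixes X :: "'a \<Rightarrow> real^'d^'d"
  assumes [measurable]: "X \<in> borel_measurable M" and sym: "\<And>\<omega>. symmetric_matrix (X \<omega>)"
  shows "(\<lambda>\<omega>. lambda_max (X \<omega>)) \<in> borel_measurable M"
  by (rule borel_measurable_LIMSEQ_real[OF lambda_max_limit[OF sym]]) measurable

lemma trace_mexp_pos: "symmetric_matrix X \<Longrightarrow> 0 < trace (mexp X)"
  using exp_lambda_max_le_trace[of X] exp_gt_zero[of "lambda_max X"] by linarith

section \<open>Integrating out independent summands\<close>

context prob_space
begin

lemma indep_var_sum_insert: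
  fixes X :: "'i \<Rightarrow> 'a \<Rightarrow> 'b::{second_countable_topology, real_normed_vector}"
  assumes I: "finite I" "i \<notin> I" and indep: "indep_vars (\<lambda>_. borel) X (insert i I)"
  shows "indep_var borel (\<lambda>\<omega>. \<Sum>i\<in>I. X i \<omega>) borel (X i)"
proof -
  have "indep_var borel ((\<lambda>f. \<Sum>i\<in>I. f i) \<circ> (\<lambda>\<omega>. restrict (\<lambda>i. X i \<omega>) I))
     borel ((\<lambda>f. f i) \<circ> (\<lambda>\<omega>. restrict (\<lambda>i. X i \<omega>) {i}))"
    using I by (intro indep_var_compose[OF indep_var_restrict[OF indep]]) auto
  also have "((\<lambda>f. f i) \<circ> (\<lambda>\<omega>. restrict (\<lambda>i. X i \<omega>) {i})) = X i"
    by auto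
  also have "((\<lambda>f. \<Sum>i\<in>I. f i) \<circ> (\<lambda>\<omega>. restrict (\<lambda>i. X i \<omega>) I)) = (\<lambda>\<omega>. \<Sum>i\<in>I. X i \<omega>)"
    by (auto cong: rev_conj_cong)
  finally show ?thesis .
qed

text \<open>Tonelli for the product law of the pair. With nonnegative integrals nothing has to be
  known beforehand about integrability of the exponential of the whole sum.\<close>

lemma indep_var_nn_integral:
  assumes "indep_var S X T Z" and F: "F \<in> borel_measurable (S \<Otimes>\<^sub>M T)"
  shows "(\<integral>\<^sup>+\<omega>. F (X \<omega>, Z \<omega>) \<partial>M) = (\<integral>\<^sup>+\<omega>. \<integral>\<^sup>+\<omega>'. F (X \<omega>, Z \<omega>') \<partial>M \<partial>M)"
proof -
  have X [measurable]: "X \<in> measurable M S" and Z [measurable]: "Z \<in> measurable M T"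
    and eq: "distr M S X \<Otimes>\<^sub>M distr M T Z = distr M (S \<Otimes>\<^sub>M T) (\<lambda>x. (X x, Z x))"
    using assms(1) unfolding indep_var_distribution_eq by auto
  interpret Z: prob_space "distr M T Z" by (rule prob_space_distr) measurable
  have F1: "(\<lambda>s. \<integral>\<^sup>+x. F (s, x) \<partial>distr M T Z) \<in> borel_measurable S"
  proof (rule Z.borel_measurable_nn_integral)
    show "(\<lambda>(s, x). F (s, x)) \<in> borel_measurable (S \<Otimes>\<^sub>M distr M T Z)"
      using F by (simp add: measurable_cong_sets[OF sets_pair_measure_cong[OF refl sets_distr] refl])
  qed
  have "(\<integral>\<^sup>+\<omega>. F (X \<omega>, Z \<omega>) \<partial>M) = integral\<^sup>N (distr M (S \<Otimes>\<^sub>M T) (\<lambda>x. (X x, Z x))) F"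
    using F by (subst nn_integral_distr) auto
  also have "\<dots> = (\<integral>\<^sup>+s. \<integral>\<^sup>+x. F (s, x) \<partial>distr M T Z \<partial>distr M S X)"
    unfolding eq[symmetric] using F
    by (subst Z.nn_integral_fst) (simp_all add: measurable_cong_sets[OF sets_pair_measure_cong[OF sets_distr sets_distr] refl])
  also have "\<dots> = (\<integral>\<^sup>+\<omega>. \<integral>\<^sup>+x. F (X \<omega>, x) \<partial>distr M T Z \<partial>M)"
    using F1 by (subst nn_integral_distr) auto
  also have "\<dots> = (\<integral>\<^sup>+\<omega>. \<integral>\<^sup>+\<omega>'. F (X \<omega>, Z \<omega>') \<partial>M \<partial>M)"
  proof (rule nn_integral_cong)
    fix \<omega> assume "\<omega> \<in> space M"
    then have "X \<omega> \<in> space S" by (rule measurable_space[OF X])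
    then show "(\<integral>\<^sup>+x. F (X \<omega>, x) \<partial>distr M T Z) = (\<integral>\<^sup>+\<omega>'. F (X \<omega>, Z \<omega>') \<partial>M)"
      using F by (subst nn_integral_distr) (auto intro: measurable_Pair2)
  qed
  finally show ?thesis .
qed

text \<open>\<open>H\<close> must vary in the induction. With the partial sum frozen, it joins
  \<open>H\<close> as the constant of \<open>lieb_jensen\<close>, which replaces \<open>X i\<close>
  by \<open>L i\<close>; then \<open>L i\<close> joins \<open>H\<close> in the induction
  hypothesis.\<close>

theorem trace_mgf_subadditive:
  fixes X :: "'i \<Rightarrow> 'a \<Rightarrow> real^'d^'d" and L :: "'i \<Rightarrow> real^'d^'d"
  assumes "finite I" and "indep_vars (\<lambda>_. borel) X I"
    and "\<And>i \<omega>. i \<in> I \<Longrightarrow> symmetric_matrix (X i \<omega>)"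
    and "\<And>i. i \<in> I \<Longrightarrow> symmetric_matrix (L i)"
    and "\<And>i. i \<in> I \<Longrightarrow> integrable M (\<lambda>\<omega>. mexp (X i \<omega>))"
    and "\<And>i. i \<in> I \<Longrightarrow> mexp (L i) = expectation (\<lambda>\<omega>. mexp (X i \<omega>))"
    and "symmetric_matrix H"
  shows "(\<integral>\<^sup>+\<omega>. ennreal (trace (mexp (H + (\<Sum>i\<in>I. X i \<omega>)))) \<partial>M) \<le> ennreal (trace (mexp (H + (\<Sum>i\<in>I. L i))))"
  using assms
proof (induction I arbitrary: H rule: finite_induct)
  case empty
  show ?case by (simp add: emeasure_space_1)
next
  case (insert i I)
  have meas [measurable]: "X j \<in> borel_measurable M" if "j \<in> insert i I" for j
    using insert.prems(1) that unfolding indep_vars_def by blast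
  have [measurable]: "X i \<in> borel_measurable M" by (rule meas) simp
  have indepI: "indep_vars (\<lambda>_. borel) X I"
    by (rule indep_vars_subset[OF insert.prems(1)]) auto
  let ?F = "\<lambda>(s, x). ennreal (trace (mexp (H + s + x)))"
  have "(\<integral>\<^sup>+\<omega>. ennreal (trace (mexp (H + (\<Sum>j\<in>insert i I. X j \<omega>)))) \<partial>M)
      = (\<integral>\<^sup>+\<omega>. ?F (\<Sum>j\<in>I. X j \<omega>, X i \<omega>) \<partial>M)"
    using insert.hyps by (simp add: add_ac)
  also have "\<dots> = (\<integral>\<^sup>+\<omega>. \<integral>\<^sup>+\<omega>'. ?F (\<Sum>j\<in>I. X j \<omega>, X i \<omega>') \<partial>M \<partial>M)"
    by (rule indep_var_nn_integral[OF indep_var_sum_insert[OF insert.hyps insert.prems(1)]]) measurable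
  also have "\<dots> \<le> (\<integral>\<^sup>+\<omega>. ennreal (trace (mexp ((H + L i) + (\<Sum>j\<in>I. X j \<omega>)))) \<partial>M)"
  proof (rule nn_integral_mono)
    fix \<omega>
    let ?H = "H + (\<Sum>j\<in>I. X j \<omega>)"
    have symH: "symmetric_matrix ?H"
      using insert.prems(2,6) by (intro symmetric_matrix_add symmetric_matrix_sum) auto
    have symX: "symmetric_matrix (X i \<omega>)" for \<omega> using insert.prems(2) by simp
    have lieb: "integrable M (\<lambda>\<omega>'. trace (mexp (?H + X i \<omega>')))"
      "expectation (\<lambda>\<omega>'. trace (mexp (?H + X i \<omega>'))) \<le> trace (mexp (?H + L i))"
      using lieb_jensen[OF symX symH, of "L i"] insert.prems(3-5) by auto
    have "(\<integral>\<^sup>+\<omega>'. ennreal (trace (mexp (?H + X i \<omega>'))) \<partial>M) = ennreal (expectation (\<lambda>\<omega>'. trace (mexp (?H + X i \<omega>'))))"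
      by (rule nn_integral_eq_integral[OF lieb(1)])
         (intro AE_I2 less_imp_le trace_mexp_pos symmetric_matrix_add symH symX)
    also have "\<dots> \<le> ennreal (trace (mexp (?H + L i)))" using lieb(2) by (rule ennreal_leI)
    finally show "(\<integral>\<^sup>+\<omega>'. ?F (\<Sum>j\<in>I. X j \<omega>, X i \<omega>') \<partial>M) \<le> ennreal (trace (mexp ((H + L i) + (\<Sum>j\<in>I. X j \<omega>))))"
      by (simp add: add_ac)
  qed
  also have "\<dots> \<le> ennreal (trace (mexp ((H + L i) + (\<Sum>j\<in>I. L j))))"
    using insert.prems by (intro insert.IH indepI symmetric_matrix_add) auto
  also have "(H + L i) + (\<Sum>j\<in>I. L j) = H + (\<Sum>j\<in>insert i I. L j)"
    using insert.hyps by (simp add: add_ac)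
  finally show ?case .
qed

end

section \<open>Tail and expectation bounds\<close>

lemma norm_outer_self: "norm (outer_self y) = y \<bullet> y"
proof -
  have "outer_self y \<bullet> outer_self y = (y \<bullet> y) * (y \<bullet> y)"
    by (simp add: outer_self_def inner_vec_def sum_product mult_ac)
  then have "(norm (outer_self y))\<^sup>2 = (y \<bullet> y)\<^sup>2"
    by (simp only: power2_norm_eq_inner power2_eq_square[of "y \<bullet> y"])
  then show ?thesis by (simp add: power2_eq_iff_nonneg)
qed

locale independent_gaussians = prob_space M for M :: "'a measure" +
  fixes I :: "'i set" and Y :: "'i \<Rightarrow> 'a \<Rightarrow> real^'d" and A :: "'i \<Rightarrow> real^'d^'d" and R s :: real
  assumes I: "finite I"
    and sym: "\<And>j. j \<in> I \<Longrightarrow> symmetric_matrix (A j)"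
    and psd: "\<And>j. j \<in> I \<Longrightarrow> pos_semidef (A j)"
    and gaussian: "\<And>j. j \<in> I \<Longrightarrow> gaussian_vector M (Y j) 0 (A j)"
    and indep: "indep_vars (\<lambda>_. borel) Y I"
    and R: "\<And>j. j \<in> I \<Longrightarrow> trace (A j) + 4 * spectral_norm (A j) \<le> R"
    and s: "lambda_max (\<Sum>j\<in>I. trace (A j) *\<^sub>R A j + 2 *\<^sub>R (A j ** A j)) \<le> s"
begin

definition deviation :: "'a \<Rightarrow> real^'d^'d" where
  "deviation \<omega> = (\<Sum>j\<in>I. outer_self (Y j \<omega>)) - (\<Sum>j\<in>I. A j)"

lemma deviation_symmetric: "symmetric_matrix (deviation \<omega>)"
proof -
  have "deviation \<omega> = (\<Sum>j\<in>I. outer_self (Y j \<omega>)) + (-1) *\<^sub>R (\<Sum>j\<in>I. A j)" by (simp add: deviation_def)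
  also have "symmetric_matrix \<dots>"
    by (intro symmetric_matrix_add symmetric_matrix_scaleR symmetric_matrix_sum symmetric_matrix_outer_self sym)
  finally show ?thesis .
qed

lemma measurable_outer_self_Y:
  assumes "j \<in> I"
  shows "(\<lambda>\<omega>. outer_self (Y j \<omega>)) \<in> borel_measurable M"
proof -
  have [measurable]: "Y j \<in> borel_measurable M"
    using gaussian[OF assms] by (simp add: gaussian_vector_def)
  show ?thesis
    unfolding outer_self_def by (rule borel_measurable_matrixI, unfold vec_lambda_beta) measurable
qed

lemma measurable_deviation [measurable]: "deviation \<in> borel_measurable M"
  unfolding deviation_def[abs_def] using measurable_outer_self_Y by measurable

lemma integrable_deviation: "integrable M deviation"
  unfolding deviation_def[abs_def]
proof (intro Bochner_Integration.integrable_diff Bochner_Integration.integrable_sum)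
  fix j assume j: "j \<in> I"
  interpret centered_gaussian M "Y j" "A j"
    using j gaussian sym psd by unfold_locales auto
  show "integrable M (\<lambda>\<omega>. outer_self (Y j \<omega>))"
  proof (rule Bochner_Integration.integrable_bound)
    show "integrable M (\<lambda>\<omega>. Y j \<omega> \<bullet> Y j \<omega>)" by (rule integrable_poly_growth[OF poly_growth_inner_self])
    show "AE \<omega> in M. norm (outer_self (Y j \<omega>)) \<le> norm (Y j \<omega> \<bullet> Y j \<omega>)" by (simp add: norm_outer_self)
  qed (rule measurable_outer_self_Y[OF j])
qed simp

lemma measurable_lambda_max_deviation [measurable]: "(\<lambda>\<omega>. lambda_max (deviation \<omega>)) \<in> borel_measurable M"
  by (intro borel_measurable_lambda_max measurable_deviation deviation_symmetric)

lemma integrable_lambda_max_deviation: "integrable M (\<lambda>\<omega>. lambda_max (deviation \<omega>))"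
  by (rule Bochner_Integration.integrable_bound[OF integrable_norm[OF integrable_deviation]])
     (use abs_lambda_max_le_norm[OF deviation_symmetric] in auto)

lemma log_mgf_summand:
  assumes j: "j \<in> I" and \<theta>: "0 \<le> \<theta>" "\<theta> * R < 1"
  shows "integrable M (\<lambda>\<omega>. mexp (\<theta> *\<^sub>R outer_self (Y j \<omega>)))"
    and "\<exists>L. symmetric_matrix L \<and> mexp L = expectation (\<lambda>\<omega>. mexp (\<theta> *\<^sub>R outer_self (Y j \<omega>))) \<and>
      (\<forall>x. x \<bullet> (L *v x) \<le> x \<bullet> ((\<theta> *\<^sub>R A j + (\<theta>\<^sup>2 / (2 * (1 - \<theta> * R))) *\<^sub>R
        (trace (A j) *\<^sub>R A j + 2 *\<^sub>R (A j ** A j))) *v x))"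
proof -
  obtain u a where "eigenbasis (A j) u a" using spectral_theorem[OF sym[OF j]] .
  then interpret centered_gaussian_eigenbasis M "Y j" "A j" u a
    using j gaussian sym psd by unfold_locales auto
  show "integrable M (\<lambda>\<omega>. mexp (\<theta> *\<^sub>R outer_self (Y j \<omega>)))"
    by (rule integrable_mexp_outer_self[OF R[OF j] \<theta>])
  show "\<exists>L. symmetric_matrix L \<and> mexp L = expectation (\<lambda>\<omega>. mexp (\<theta> *\<^sub>R outer_self (Y j \<omega>))) \<and>
      (\<forall>x. x \<bullet> (L *v x) \<le> x \<bullet> ((\<theta> *\<^sub>R A j + (\<theta>\<^sup>2 / (2 * (1 - \<theta> * R))) *\<^sub>R
        (trace (A j) *\<^sub>R A j + 2 *\<^sub>R (A j ** A j))) *v x))"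
    by (rule log_mgf_outer_self[OF R[OF j] \<theta>]) blast
qed

text \<open>The largest eigenvalue is traded for the trace of the exponential and back. The way back
  costs the factor d.\<close>

lemma exp_lambda_max_bound:
  assumes \<theta>: "0 \<le> \<theta>" "\<theta> * R < 1"
  shows "integrable M (\<lambda>\<omega>. exp (\<theta> * lambda_max (deviation \<omega>)))"
    and "expectation (\<lambda>\<omega>. exp (\<theta> * lambda_max (deviation \<omega>))) \<le>
      real CARD('d) * exp (\<theta>\<^sup>2 / (2 * (1 - \<theta> * R)) * s)"
proof -
  let ?f = "\<theta>\<^sup>2 / (2 * (1 - \<theta> * R))"
  define V where "V = (\<lambda>j. trace (A j) *\<^sub>R A j + 2 *\<^sub>R (A j ** A j))"
  define H where "H = (- \<theta>) *\<^sub>R (\<Sum>j\<in>I. A j)"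
  have "\<forall>j\<in>I. \<exists>L. symmetric_matrix L \<and> mexp L = expectation (\<lambda>\<omega>. mexp (\<theta> *\<^sub>R outer_self (Y j \<omega>))) \<and>
      (\<forall>x. x \<bullet> (L *v x) \<le> x \<bullet> ((\<theta> *\<^sub>R A j + ?f *\<^sub>R V j) *v x))"
    unfolding V_def using log_mgf_summand(2)[OF _ \<theta>] by blast
  then obtain L where L: "\<And>j. j \<in> I \<Longrightarrow> symmetric_matrix (L j)"
    "\<And>j. j \<in> I \<Longrightarrow> mexp (L j) = expectation (\<lambda>\<omega>. mexp (\<theta> *\<^sub>R outer_self (Y j \<omega>)))"
    "\<And>j x. j \<in> I \<Longrightarrow> x \<bullet> (L j *v x) \<le> x \<bullet> ((\<theta> *\<^sub>R A j + ?f *\<^sub>R V j) *v x)"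
    by metis
  have f: "0 \<le> ?f" using \<theta> by simp
  have symH: "symmetric_matrix H"
    unfolding H_def by (intro symmetric_matrix_scaleR symmetric_matrix_sum sym)
  have symV: "symmetric_matrix (V j)" if "j \<in> I" for j
    using sym[OF that] unfolding V_def
    by (intro symmetric_matrix_add symmetric_matrix_scaleR) (simp_all add: symmetric_matrix_def matrix_transpose_mul)
  have symVs: "symmetric_matrix (sum V I)" by (intro symmetric_matrix_sum symV)
  have lam: "\<theta> * lambda_max (deviation \<omega>) = lambda_max (\<theta> *\<^sub>R deviation \<omega>)" for \<omega>
    by (rule lambda_max_scaleR[OF deviation_symmetric \<theta>(1), symmetric])
  have "(\<integral>\<^sup>+\<omega>. ennreal (exp (\<theta> * lambda_max (deviation \<omega>))) \<partial>M) \<le> (\<integral>\<^sup>+\<omega>. ennreal (trace (mexp (\<theta> *\<^sub>R deviation \<omega>))) \<partial>M)"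
    unfolding lam
    by (intro nn_integral_mono ennreal_leI exp_lambda_max_le_trace symmetric_matrix_scaleR deviation_symmetric)
  also have "\<dots> = (\<integral>\<^sup>+\<omega>. ennreal (trace (mexp (H + (\<Sum>j\<in>I. \<theta> *\<^sub>R outer_self (Y j \<omega>))))) \<partial>M)"
  proof -
    have "\<theta> *\<^sub>R deviation \<omega> = H + (\<Sum>j\<in>I. \<theta> *\<^sub>R outer_self (Y j \<omega>))" for \<omega>
      by (simp add: deviation_def H_def scaleR_diff_right scaleR_sum_right sum_negf)
    then show ?thesis by (simp only:)
  qed
  also have "\<dots> \<le> ennreal (trace (mexp (H + (\<Sum>j\<in>I. L j))))"
  proof (rule trace_mgf_subadditive[OF I])
    show "indep_vars (\<lambda>_. borel) (\<lambda>j \<omega>. \<theta> *\<^sub>R outer_self (Y j \<omega>)) I"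
    proof (rule indep_vars_compose2[OF indep, of "\<lambda>_ y. \<theta> *\<^sub>R outer_self y"])
      have [measurable]: "(\<lambda>y :: real^'d. outer_self y) \<in> borel_measurable borel"
        unfolding outer_self_def by (rule borel_measurable_matrixI, unfold vec_lambda_beta) measurable
      show "(\<lambda>y :: real^'d. \<theta> *\<^sub>R outer_self y) \<in> borel_measurable borel" by measurable
    qed
  qed (use L symH log_mgf_summand(1)[OF _ \<theta>] in \<open>auto intro: symmetric_matrix_scaleR symmetric_matrix_outer_self\<close>)
  also have "trace (mexp (H + (\<Sum>j\<in>I. L j))) \<le> trace (mexp (?f *\<^sub>R sum V I))"
  proof (rule trace_mexp_mono)
    show "symmetric_matrix (H + (\<Sum>j\<in>I. L j))" "symmetric_matrix (?f *\<^sub>R sum V I)"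
      by (intro symmetric_matrix_add symmetric_matrix_scaleR symmetric_matrix_sum symH symV L(1); assumption)+
    fix x
    have "x \<bullet> ((H + (\<Sum>j\<in>I. L j)) *v x) = x \<bullet> (H *v x) + (\<Sum>j\<in>I. x \<bullet> (L j *v x))"
      by (simp add: matrix_vector_mult_add_rdistrib sum_matrix_vector_mult inner_add_right inner_sum_right)
    also have "\<dots> \<le> x \<bullet> (H *v x) + (\<Sum>j\<in>I. x \<bullet> ((\<theta> *\<^sub>R A j + ?f *\<^sub>R V j) *v x))"
      by (intro add_left_mono sum_mono L(3))
    \<comment> \<open>\<open>H\<close> cancels the terms \<open>\<theta> *\<^sub>R A j\<close>
      exactly, and only the variance part remains.\<close>
    also have "\<dots> = x \<bullet> ((?f *\<^sub>R sum V I) *v x)"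
      unfolding H_def matrix_vector_mult_add_rdistrib scaleR_matrix_vector_assoc[symmetric] sum_matrix_vector_mult
        inner_add_right inner_scaleR_right inner_sum_right sum.distrib sum_distrib_left
      by (simp add: sum_negf)
    finally show "x \<bullet> ((H + (\<Sum>j\<in>I. L j)) *v x) \<le> x \<bullet> ((?f *\<^sub>R sum V I) *v x)" .
  qed
  also have "\<dots> \<le> real CARD('d) * exp (lambda_max (?f *\<^sub>R sum V I))"
    by (intro trace_mexp_le_lambda_max symmetric_matrix_scaleR symVs)
  also have "\<dots> \<le> real CARD('d) * exp (?f * s)"
    unfolding lambda_max_scaleR[OF symVs f]
    using s f by (intro mult_left_mono exp_mono mult_left_mono) (auto simp: V_def)
  finally have bound: "(\<integral>\<^sup>+\<omega>. ennreal (exp (\<theta> * lambda_max (deviation \<omega>))) \<partial>M) \<le> ennreal (real CARD('d) * exp (?f * s))"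
    by (simp add: ennreal_leI)
  \<comment> \<open>Integrability is a by-product: the bound on the nonnegative integral is
    finite.\<close>
  show int: "integrable M (\<lambda>\<omega>. exp (\<theta> * lambda_max (deviation \<omega>)))"
    by (rule integrableI_bounded) (use le_less_trans[OF bound ennreal_less_top] in simp_all)
  show "expectation (\<lambda>\<omega>. exp (\<theta> * lambda_max (deviation \<omega>))) \<le> real CARD('d) * exp (?f * s)"
    using bound unfolding nn_integral_eq_integral[OF int AE_I2[OF exp_ge_zero]]
    by (subst (asm) ennreal_le_iff) auto
qed

lemma lambda_max_tail:
  assumes \<theta>: "0 < \<theta>" "\<theta> * R < 1"
  shows "prob {\<omega> \<in> space M. lambda_max (deviation \<omega>) \<ge> t} \<le>
    real CARD('d) * exp (\<theta>\<^sup>2 / (2 * (1 - \<theta> * R)) * s - \<theta> * t)"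
proof -
  have \<theta>': "0 \<le> \<theta>" using \<theta>(1) by simp
  note E = exp_lambda_max_bound[OF \<theta>' \<theta>(2)]
  have "prob {\<omega> \<in> space M. lambda_max (deviation \<omega>) \<ge> t} \<le> exp (- \<theta> * t) * expectation (\<lambda>\<omega>. exp (\<theta> * lambda_max (deviation \<omega>)))"
    using Chernoff_ineq_ge[OF \<theta>(1), of "space M" "\<lambda>\<omega>. lambda_max (deviation \<omega>)" t]
      integrable_mult_indicator[OF sets.top E(1)] set_integral_space[OF E(1)]
    by (simp add: set_integrable_def)
  also have "\<dots> \<le> exp (- \<theta> * t) * (real CARD('d) * exp (\<theta>\<^sup>2 / (2 * (1 - \<theta> * R)) * s))"
    by (intro mult_left_mono E(2)) auto
  also have "\<dots> = real CARD('d) * exp (\<theta>\<^sup>2 / (2 * (1 - \<theta> * R)) * s - \<theta> * t)"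
    by (simp add: exp_add[symmetric] algebra_simps)
  finally show ?thesis .
qed

text \<open>Jensen's inequality for the logarithm, obtained from 1 + x <= e^x with x centred at
  \<open>?c\<close>, the logarithm of the bound on the exponential moment.\<close>

lemma lambda_max_expectation:
  assumes \<theta>: "0 < \<theta>" "\<theta> * R < 1"
  shows "\<theta> * expectation (\<lambda>\<omega>. lambda_max (deviation \<omega>)) \<le> ln (real CARD('d)) + \<theta>\<^sup>2 / (2 * (1 - \<theta> * R)) * s"
proof -
  have \<theta>': "0 \<le> \<theta>" using \<theta>(1) by simp
  note E = exp_lambda_max_bound[OF \<theta>' \<theta>(2)]
  let ?c = "ln (real CARD('d)) + \<theta>\<^sup>2 / (2 * (1 - \<theta> * R)) * s"
  have c: "exp ?c = real CARD('d) * exp (\<theta>\<^sup>2 / (2 * (1 - \<theta> * R)) * s)" by (simp add: exp_add)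
  have "1 + (expectation (\<lambda>\<omega>. \<theta> * lambda_max (deviation \<omega>)) - ?c) = expectation (\<lambda>\<omega>. 1 + (\<theta> * lambda_max (deviation \<omega>) - ?c))"
    using integrable_lambda_max_deviation by (simp add: prob_space)
  also have "\<dots> \<le> expectation (\<lambda>\<omega>. exp (\<theta> * lambda_max (deviation \<omega>)) * exp (- ?c))"
  proof (rule integral_mono)
    show "1 + (\<theta> * lambda_max (deviation \<omega>) - ?c) \<le> exp (\<theta> * lambda_max (deviation \<omega>)) * exp (- ?c)" for \<omega>
      using exp_ge_add_one_self[of "\<theta> * lambda_max (deviation \<omega>) - ?c"]
      by (simp only: exp_add[symmetric] add_uminus_conv_diff)
  qed (use integrable_lambda_max_deviation E(1) in auto)
  also have "\<dots> = expectation (\<lambda>\<omega>. exp (\<theta> * lambda_max (deviation \<omega>))) * exp (- ?c)" by simp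
  also have "\<dots> \<le> exp ?c * exp (- ?c)"
    unfolding c by (intro mult_right_mono E(2)) simp
  also have "\<dots> = 1" by (simp only: exp_add[symmetric] right_minus exp_zero)
  finally show ?thesis by simp
qed

text \<open>Division by zero yields 0 in HOL, so for a vanishing denominator the exponential would
  read 1; the case distinction states the intended limit exp(-infinity) = 0.\<close>

lemma tail_bound:
  assumes R0: "0 \<le> R" and s0: "0 \<le> s" and t: "0 < t"
  shows "prob {\<omega> \<in> space M. lambda_max (deviation \<omega>) \<ge> t} \<le>
    (if 2 * s + 2 * R * t = 0 then 0 else real CARD('d) * exp (- (t\<^sup>2 / (2 * s + 2 * R * t))))"
    (is "?p \<le> _")
proof -
  have Rt: "0 \<le> R * t" using R0 t by simp
  consider "s > 0" | "s = 0" "R > 0" | "s = 0" "R = 0" using R0 s0 by fastforce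
  then show ?thesis
  proof cases
    case 1
    define D where "D = s + R * t"
    have D: "D > 0" using 1 Rt by (simp add: D_def)
    \<comment> \<open>With this choice the quadratic term of the exponent is exactly half of
      \<open>\<theta> * t\<close>, leaving -t^2 / (2 D).\<close>
    define \<theta> where "\<theta> = t / D"
    have 2: "1 - \<theta> * R = s / D" using D by (simp add: \<theta>_def field_simps) (simp add: D_def)
    have "0 < 1 - \<theta> * R" unfolding 2 by (rule divide_pos_pos[OF 1 D])
    then have "0 < \<theta>" "\<theta> * R < 1" using D t by (simp_all add: \<theta>_def)
    from lambda_max_tail[OF this, of t]
    have "?p \<le> real CARD('d) * exp (\<theta>\<^sup>2 / (2 * (s / D)) * s - \<theta> * t)" unfolding 2 .
    also have "\<theta>\<^sup>2 / (2 * (s / D)) * s - \<theta> * t = - (t\<^sup>2 / (2 * D))"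
      using D 1 by (simp add: \<theta>_def field_simps power2_eq_square)
    finally show ?thesis using D by (simp add: D_def algebra_simps)
  next
    case 2
    \<comment> \<open>The previous choice would give \<open>\<theta> * R = 1\<close>, which is
      excluded. Half of it suffices, because for s = 0 the quadratic term is absent and the exponent
      is already -t / (2 R).\<close>
    define \<theta> where "\<theta> = 1 / (2 * R)"
    have "0 < \<theta>" "\<theta> * R < 1" using 2 by (auto simp: \<theta>_def)
    from lambda_max_tail[OF this, of t]
    have "?p \<le> real CARD('d) * exp (- \<theta> * t)" using 2 by simp
    also have "- \<theta> * t = - (t\<^sup>2 / (2 * s + 2 * R * t))"
      using 2 t by (simp add: \<theta>_def power2_eq_square)
    finally show ?thesis using 2 t by simp
  next
    case 3
    have "?p \<le> 0"
    proof (rule ccontr)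
      assume "\<not> ?p \<le> 0"
      then have p: "0 < ?p" by simp
      let ?d = "real CARD('d)"
      \<comment> \<open>Every positive \<open>\<theta>\<close> is admissible here. Taking
        \<open>x / t\<close> with this x turns the bound into ?p <= d e^(-x) < d / x = ?p.\<close>
      define x where "x = ?d / ?p"
      have d: "?d > 0" and x: "x > 0" using p by (auto simp: x_def)
      have "?p \<le> ?d * exp (- x)"
        using lambda_max_tail[of "x / t" t] 3 t x by simp
      also have "\<dots> = ?d / exp x" by (simp add: exp_minus divide_inverse)
      also have "x < exp x" using exp_ge_add_one_self[of x] by linarith
      then have "?d / exp x < ?d / x"
        using d x by (intro divide_strict_left_mono mult_pos_pos) auto
      also have "\<dots> = ?p" using p d by (simp add: x_def)
      finally show False by simp
    qed
    then show ?thesis using 3 by simp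
  qed
qed

lemma expectation_bound:
  assumes R0: "0 \<le> R" and s_eq: "s = \<sigma>\<^sup>2" and \<sigma>: "0 \<le> \<sigma>"
  shows "expectation (\<lambda>\<omega>. lambda_max (deviation \<omega>))
    \<le> \<sigma> * (2 * sqrt (ln (real CARD('d))) + 1) + 4 * R * (ln (real CARD('d)) + 1)"
    (is "?E \<le> _")
proof -
  define l where "l = ln (real CARD('d))"
  have l: "0 \<le> l" by (simp add: l_def Suc_leI)
  \<comment> \<open>The choice 1 / (v + R) turns 1 - \<open>\<theta>\<close> R into v
    \<open>\<theta>\<close>, which removes the singular denominator and leaves v > 0 to be
    optimised.\<close>
  have bound: "?E \<le> l * (v + R) + \<sigma>\<^sup>2 / (2 * v)" if v: "0 < v" for v
  proof -
    define \<theta> where "\<theta> = 1 / (v + R)"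
    have vR: "v + R > 0" using v R0 by simp
    have 1: "1 - \<theta> * R = v * \<theta>" using vR by (simp add: \<theta>_def field_simps)
    have \<theta>: "0 < \<theta>" "\<theta> * R < 1" using vR v by (auto simp: \<theta>_def)
    have "\<theta> * ?E \<le> l + \<theta>\<^sup>2 / (2 * (v * \<theta>)) * \<sigma>\<^sup>2"
      using lambda_max_expectation[OF \<theta>] unfolding 1 s_eq l_def .
    also have "\<dots> = \<theta> * (l * (v + R) + \<sigma>\<^sup>2 / (2 * v))"
    proof -
      have "\<theta> * (v + R) = 1" using vR by (simp add: \<theta>_def)
      then have "\<theta> * (l * (v + R)) = l" by (simp add: mult.left_commute)
      moreover have "\<theta>\<^sup>2 / (2 * (v * \<theta>)) * \<sigma>\<^sup>2 = \<theta> * (\<sigma>\<^sup>2 / (2 * v))"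
        using \<theta>(1) by (simp add: power2_eq_square)
      ultimately show ?thesis by (simp add: distrib_left)
    qed
    finally show ?thesis using \<theta>(1) by simp
  qed
  have Rl: "l * R \<le> 4 * R * (l + 1)" using mult_nonneg_nonneg[OF l R0] R0 by (simp add: algebra_simps)
  have "?E \<le> \<sigma> * (2 * sqrt l + 1) + 4 * R * (l + 1)"
  proof (cases "\<sigma> = 0")
    case True
    \<comment> \<open>Without variance the bound decreases to l R as v tends to 0, hence an
      arbitrary slack e.\<close>
    have "?E \<le> l * R + e" if "e > 0" for e
    proof -
      have "?E \<le> l * (e / (l + 1) + R)" using bound[of "e / (l + 1)"] that l True by simp
      also have "l * (e / (l + 1)) \<le> e" using that l by (simp add: field_simps)
      then have "l * (e / (l + 1) + R) \<le> l * R + e" by (simp add: distrib_left)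
      finally show ?thesis .
    qed
    then have "?E \<le> l * R" by (rule field_le_epsilon)
    then show ?thesis using Rl True by simp
  next
    case False
    then have \<sigma>: "\<sigma> > 0" using \<sigma> by simp
    define q where "q = sqrt (2 * l)"
    have q: "0 \<le> q" "l = q\<^sup>2 / 2" using l by (auto simp: q_def)
    \<comment> \<open>The minimiser of l v + sigma^2 / (2 v) would be sigma / q. The added 1 keeps v
      finite when d = 1, where q = 0, and is the origin of the summand 1 next to 2 sqrt(log
      d).\<close>
    define v where "v = \<sigma> / (q + 1)"
    have v: "v > 0" using \<sigma> q by (simp add: v_def)
    have "l * v = \<sigma> / 2 * (q * (q / (q + 1)))"
      unfolding q(2) v_def by (simp add: power2_eq_square)
    also have "\<dots> \<le> \<sigma> / 2 * (q * 1)"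
      using q \<sigma> by (intro mult_left_mono) auto
    finally have "l * v \<le> \<sigma> / 2 * q" by simp
    moreover have "\<sigma>\<^sup>2 / (2 * v) = \<sigma> / 2 * (q + 1)"
      using \<sigma> q by (simp add: v_def power2_eq_square)
    moreover have "?E \<le> l * v + l * R + \<sigma>\<^sup>2 / (2 * v)" using bound[OF v] by (simp add: distrib_left)
    ultimately have "?E \<le> \<sigma> * (q + 1) + l * R" using \<sigma> by (simp add: algebra_simps)
    moreover have "q \<le> 2 * sqrt l"
    proof -
      have "sqrt (2 * l) \<le> sqrt (4 * l)" using l by simp
      then show ?thesis by (simp add: q_def real_sqrt_mult)
    qed
    then have "\<sigma> * (q + 1) \<le> \<sigma> * (2 * sqrt l + 1)" using \<sigma> by (intro mult_left_mono) auto
    ultimately show ?thesis using Rl by linarith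
  qed
  then show ?thesis by (simp add: l_def)
qed

end

theorem theoremA2:
  fixes M :: "'a measure"
    and J :: nat
    and Y :: "nat \<Rightarrow> 'a \<Rightarrow> real^'d"
    and A :: "nat \<Rightarrow> real^'d^'d"
    and Asum :: "real^'d^'d"
    and \<sigma> R :: real
  assumes "prob_space M"
    and "J \<ge> 1"
    and "\<And>j. j \<in> {1..J} \<Longrightarrow> symmetric_matrix (A j)"
    and "\<And>j. j \<in> {1..J} \<Longrightarrow> pos_semidef (A j)"
    and "\<And>j. j \<in> {1..J} \<Longrightarrow> gaussian_vector M (Y j) 0 (A j)"
    and "prob_space.indep_vars M (\<lambda>_. borel) Y {1..J}"
    and "Asum = (\<Sum>j=1..J. A j)"
    and "\<sigma> \<ge> 0"
    and "\<sigma>\<^sup>2 = lambda_max (\<Sum>j=1..J. trace (A j) *\<^sub>R A j + 2 *\<^sub>R (A j ** A j))"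
    and "R = Max ((\<lambda>j. trace (A j) + 4 * spectral_norm (A j)) ` {1..J})"
  shows "(\<forall>t>0.
            measure M {\<omega> \<in> space M. lambda_max ((\<Sum>j=1..J. outer_self (Y j \<omega>)) - Asum) \<ge> t}
              \<le> (if 2 * \<sigma>\<^sup>2 + 2 * R * t = 0 then 0
                 else real CARD('d) * exp (- (t\<^sup>2 / (2 * \<sigma>\<^sup>2 + 2 * R * t)))))
       \<and> integrable M (\<lambda>\<omega>. lambda_max ((\<Sum>j=1..J. outer_self (Y j \<omega>)) - Asum))
       \<and> prob_space.expectation M (\<lambda>\<omega>. lambda_max ((\<Sum>j=1..J. outer_self (Y j \<omega>)) - Asum))
            \<le> \<sigma> * (2 * sqrt (ln (real CARD('d))) + 1) + 4 * R * (ln (real CARD('d)) + 1)"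
proof -
  interpret prob_space M by fact
  have R: "trace (A j) + 4 * spectral_norm (A j) \<le> R" if "j \<in> {1..J}" for j
    unfolding assms(10) using that by (intro Max_ge) auto
  interpret independent_gaussians M "{1..J}" Y A R "\<sigma>\<^sup>2"
    using assms R by unfold_locales auto
  \<comment> \<open>At least one covariance matrix is present, and its trace and spectral norm are
    nonnegative.\<close>
  have R0: "0 \<le> R"
  proof -
    have j: "1 \<in> {1..J}" using assms(2) by simp
    obtain u a where "eigenbasis (A 1) u a" using spectral_theorem[OF sym[OF j]] .
    then interpret centered_gaussian_eigenbasis M "Y 1" "A 1" u a
      using j gaussian sym psd by unfold_locales auto
    show ?thesis by (rule R_nonneg[OF R[OF j]])
  qed
  have deviation: "(\<Sum>j=1..J. outer_self (Y j \<omega>)) - Asum = deviation \<omega>" for \<omega>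
    unfolding deviation_def assms(7) ..
  show ?thesis
    unfolding deviation
    using tail_bound[OF R0 zero_le_power2] integrable_lambda_max_deviation expectation_bound[OF R0 refl assms(8)]
    by blast
qed

end
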